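(* Let $\Omega\subset\mathbb{R}^2$ be a bounded polygonal domain, $f\in L^2(\Omega)$, $\kappa$ a positive coefficient, in the discontinuous Galerkin setting described in the context, with $\delta\ge\delta_0$. Let $u^*_h=\{u^*_i\}_{i=1}^N\in X_h(\Omega)$ solve $a^{DG}_h(u^*_h,v)=f(v)$ for all $v\in X_h(\Omega)$, and let $u_H^{ms,II}\in X_H^{II}(\Omega)$ solve $a^{DG}_h(u_H^{ms,II},v_H)=f(v_H)$ for all $v_H\in X_H^{II}(\Omega)$. In each subdomain write $$u^*_i=\sum_{\ell=1}^{N_i}c_\ell(u^*_i)\psi^{II}_{i,\ell},\qquad a_i(u^*_i,u^*_i)=\sum_{\ell=1}^{N_i}\lambda^{II}_{i,\ell}c_\ell(u^*_i)^2,$$ where $c_\ell(u^*_i)=m_i(u^*_i,\psi^{II}_{i,\ell})+m_i^\delta(u^*_i,\psi^{II}_{i,\ell})$. Then $$d_h(u^*_h-u_H^{ms,II},u^*_h-u_H^{ms,II})\le C_1\Big(1+\frac{4}{\min_{1\le i\le N}\lambda^{II}_{i,L_i+1}}\Big)\sum_{i=1}^N\sum_{\ell=L_i+1}^{N_i}\lambda^{II}_{i,\ell}c_\ell(u^*_i)^2,$$ where $C_1$ is a constant independent of the values $\kappa_i$, $h_i$, $H_i$ and of the solutions.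
   Context: $\Omega$ is split into disjoint polygonal subdomains $\Omega_1,\dots,\Omega_N$ of diameter $O(H_i)$ with $\overline\Omega=\cup_i\overline\Omega_i$, such that for $i\ne j$, $\partial\Omega_i\cap\partial\Omega_j$ is empty, a vertex, or a common edge. Each $\Omega_i$ carries a shape-regular triangulation $\mathcal T_{h_i}(\Omega_i)$ with maximal mesh size $h_i$ (possibly nonmatching across interfaces); $\kappa$ is constant on each fine triangle. $X_h(\Omega_i)$ is the space of continuous piecewise linear functions on $\mathcal T_{h_i}(\Omega_i)$ (no boundary condition), of dimension $N_i$ (number of mesh vertices), and $X_h(\Omega)=X_h(\Omega_1)\times\cdots\times X_h(\Omega_N)$, elements $v=\{v_i\}$. For a common edge $E$ of $\Omega_i,\Omega_j$, $E_{ij}$ is $E$ seen from $\Omega_i$; $E_{i\partial}=\partial\Omega_i\cap\partial\Omega$ with $v_\partial=0$. $l_{ij}=2$ for interior edges, $l_{i\partial}=1$. On $E_{ij}$, with $\kappa_i,\kappa_j$ the traces of $\kappa$ from each side, $\kappa_{ij}=2\kappa_i\kappa_j/(\kappa_i+\kappa_j)$, $h_{ij}=2h_ih_j/(h_i+h_j)$, $\kappa_{i\partial}=\kappa_i$, $h_{i\partial}=h_i$. Define $a_i(u,v)=\int_{\Omega_i}\kappa\nabla u_i\cdot\nabla v_i$; $s_i(u,v)=\sum_{E_{ij}\subset\partial\Omega_i}\frac1{l_{ij}}\int_{E_{ij}}\kappa_{ij}\big(\frac{\partial u_i}{\partial n_i}(v_j-v_i)+\frac{\partial v_i}{\partial n_i}(u_j-u_i)\big)ds$;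 $p_i(u,v)=\sum_{E_{ij}\subset\partial\Omega_i}\frac1{l_{ij}}\frac{\delta}{h_{ij}}\int_{E_{ij}}\kappa_{ij}(u_j-u_i)(v_j-v_i)ds$, $\delta>0$; $a^{DG}_h=\sum_i(a_i+s_i+p_i)$, $d_h=\sum_i(a_i+p_i)$, $f(v)=\sum_i\int_{\Omega_i}fv_i$. $\delta_0>0$ is such that for $\delta\ge\delta_0$ there are constants $\gamma_0,\gamma_1>0$ independent of $\kappa_i,h_i,H_i$ with $\gamma_0d_h(u,u)\le a^{DG}_h(u,u)\le\gamma_1d_h(u,u)$ on $X_h(\Omega)$. For $v,z\in X_h(\Omega_i)$: $m_i(v,z)=\int_{\Omega_i}\kappa vz$ and $m_i^\delta(v,z)=\sum_{E_{ij}\subset\partial\Omega_i}\frac1{l_{ij}}\frac{\delta}{h_{ij}}\int_{E_{ij}}\kappa_{ij}vz\,ds$. The eigenpairs $(\lambda^{II}_{i,\ell},\psi^{II}_{i,\ell})$, $\ell=1,\dots,N_i$, solve $a_i(\psi,z)=\lambda(m_i(\psi,z)+m_i^\delta(\psi,z))$ for all $z\in X_h(\Omega_i)$, with $0\le\lambda^{II}_{i,1}\le\cdots\le\lambda^{II}_{i,N_i}$ and eigenfunctions orthonormal with respect to $m_i+m_i^\delta$. For chosen $L_i<N_i$, $X_H^{II}(\Omega_i)=\mathrm{span}\{\psi^{II}_{i,\ell}:1\le\ell\le L_i\}$ and $X_H^{II}(\Omega)=X_H^{II}(\Omega_1)\times\cdots\times X_H^{II}(\Omega_N)$. *)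

theory Defs
  imports "HOL-Analysis.Analysis"
begin

type_synonym pt = "real^2"

definition is_tri :: "pt set \<Rightarrow> bool" where
  "is_tri T \<longleftrightarrow> (\<exists>a b c. \<not> collinear {a, b, c} \<and> T = convex hull {a, b, c})"

definition verts :: "pt set \<Rightarrow> pt set" where
  "verts T = {x. x extreme_point_of T}"

definition tri_edges :: "pt set \<Rightarrow> pt set set" where
  "tri_edges T = {closed_segment a b | a b. a \<in> verts T \<and> b \<in> verts T \<and> a \<noteq> b}"

definition conforming_triangulation :: "pt set set \<Rightarrow> pt set \<Rightarrow> bool" where
  "conforming_triangulation Tr S \<longleftrightarrow>
     finite Tr \<and> Tr \<noteq> {} \<and> (\<forall>T\<in>Tr. is_tri T) \<and> \<Union>Tr = S \<and>
     (\<forall>T\<in>Tr. \<forall>T'\<in>Tr. T \<noteq> T' \<longrightarrow>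
        T \<inter> T' = {} \<or> (\<exists>p. p \<in> verts T \<and> p \<in> verts T' \<and> T \<inter> T' = {p}) \<or>
        (\<exists>e. e \<in> tri_edges T \<and> e \<in> tri_edges T' \<and> T \<inter> T' = e))"

definition mesh_verts :: "pt set set \<Rightarrow> pt set" where
  "mesh_verts Tr = (\<Union>T\<in>Tr. verts T)"

definition mesh_size :: "pt set set \<Rightarrow> real" where
  "mesh_size Tr = Max (diameter ` Tr)"

definition is_segment :: "pt set \<Rightarrow> bool" where
  "is_segment E \<longleftrightarrow> (\<exists>a b. a \<noteq> b \<and> E = closed_segment a b)"

definition poly_edge :: "pt set \<Rightarrow> pt set \<Rightarrow> bool" where
  "poly_edge S E \<longleftrightarrow> is_segment E \<and> E \<subseteq> frontier S \<and>
     (\<forall>a b. E \<subseteq> closed_segment a b \<and> closed_segment a b \<subseteq> frontier S \<longrightarrow> closed_segment a b = E)"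

text \<open>Bounded polygonal domain (polygonal = its closure is a finite union of triangles and it
  has no slits).\<close>
definition polygonal_domain :: "pt set \<Rightarrow> bool" where
  "polygonal_domain S \<longleftrightarrow> open S \<and> connected S \<and> bounded S \<and> S \<noteq> {} \<and>
     S = interior (closure S) \<and>
     (\<exists>Tr. finite Tr \<and> (\<forall>T\<in>Tr. is_tri T) \<and> \<Union>Tr = closure S)"

definition dg_setting ::
  "pt set \<Rightarrow> nat \<Rightarrow> (nat \<Rightarrow> pt set) \<Rightarrow> (nat \<Rightarrow> pt set set) \<Rightarrow> (pt \<Rightarrow> real) \<Rightarrow> bool" where
  "dg_setting Omega N Om Tr \<kappa> \<longleftrightarrow>
     polygonal_domain Omega \<and> 1 \<le> N \<and>
     (\<forall>i\<in>{1..N}. polygonal_domain (Om i) \<and> Om i \<subseteq> Omega) \<and>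
     (\<forall>i\<in>{1..N}. \<forall>j\<in>{1..N}. i \<noteq> j \<longrightarrow> Om i \<inter> Om j = {}) \<and>
     closure Omega = (\<Union>i\<in>{1..N}. closure (Om i)) \<and>
     (\<forall>i\<in>{1..N}. \<forall>j\<in>{1..N}. i \<noteq> j \<longrightarrow>
        frontier (Om i) \<inter> frontier (Om j) = {} \<or>
        (\<exists>p. frontier (Om i) \<inter> frontier (Om j) = {p}) \<or>
        (poly_edge (Om i) (frontier (Om i) \<inter> frontier (Om j)) \<and>
         poly_edge (Om j) (frontier (Om i) \<inter> frontier (Om j)))) \<and>
     (\<forall>i\<in>{1..N}. conforming_triangulation (Tr i) (closure (Om i))) \<and>
     (\<forall>x\<in>Omega. 0 < \<kappa> x) \<and>
     (\<forall>i\<in>{1..N}. \<forall>T\<in>Tr i. \<exists>k>0. \<forall>x\<in>interior T. \<kappa> x = k)"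

text \<open>\<open>X_h(\<Omega>_i)\<close>: continuous piecewise linear functions on \<open>Tr i\<close> (no boundary condition);
  functions are taken to vanish outside \<open>closure \<Omega>_i\<close> so that they are determined by
  their values on \<open>closure \<Omega>_i\<close>.\<close>
definition Xh_loc :: "(nat \<Rightarrow> pt set) \<Rightarrow> (nat \<Rightarrow> pt set set) \<Rightarrow> nat \<Rightarrow> (pt \<Rightarrow> real) set" where
  "Xh_loc Om Tr i = {v. continuous_on (closure (Om i)) v \<and>
       (\<forall>T\<in>Tr i. \<exists>c g. \<forall>y\<in>T. v y = c + g \<bullet> y) \<and>
       (\<forall>y. y \<notin> closure (Om i) \<longrightarrow> v y = 0)}"

definition Xh :: "nat \<Rightarrow> (nat \<Rightarrow> pt set) \<Rightarrow> (nat \<Rightarrow> pt set set) \<Rightarrow> (nat \<Rightarrow> pt \<Rightarrow> real) set" where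
  "Xh N Om Tr = {v. \<forall>i\<in>{1..N}. v i \<in> Xh_loc Om Tr i}"

text \<open>Gradient (where the function is differentiable, i.e. inside fine triangles).\<close>
definition grad :: "(pt \<Rightarrow> real) \<Rightarrow> pt \<Rightarrow> pt" where
  "grad u x = (THE g. (u has_derivative (\<lambda>h. g \<bullet> h)) (at x))"

definition tri_grad :: "pt set \<Rightarrow> (pt \<Rightarrow> real) \<Rightarrow> pt" where
  "tri_grad T u = (THE g. \<exists>c. \<forall>y\<in>T. u y = c + g \<bullet> y)"

text \<open>Outward unit normal of triangle \<open>T\<close> at a boundary point \<open>x\<close> (unique in the relative
  interior of an edge).\<close>
definition tri_normal :: "pt set \<Rightarrow> pt \<Rightarrow> pt" where
  "tri_normal T x = (THE n. norm n = 1 \<and> (\<forall>y\<in>T. n \<bullet> (y - x) \<le> 0))"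

text \<open>The fine triangle of \<open>Tr i\<close> containing a point \<open>x\<close> (unique for a.e. boundary point).\<close>
definition tri_at :: "(nat \<Rightarrow> pt set set) \<Rightarrow> nat \<Rightarrow> pt \<Rightarrow> pt set" where
  "tri_at Tr i x = (SOME T. T \<in> Tr i \<and> x \<in> T)"

definition normal_deriv :: "(nat \<Rightarrow> pt set set) \<Rightarrow> nat \<Rightarrow> (pt \<Rightarrow> real) \<Rightarrow> pt \<Rightarrow> real" where
  "normal_deriv Tr i u x = tri_grad (tri_at Tr i x) u \<bullet> tri_normal (tri_at Tr i x) x"

text \<open>Value of the piecewise constant coefficient on a fine triangle, and its trace on
  \<open>\<partial>\<Omega>_i\<close> taken from the side of \<open>\<Omega>_i\<close>.\<close>
definition tri_val :: "(pt \<Rightarrow> real) \<Rightarrow> pt set \<Rightarrow> real" where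
  "tri_val \<kappa> T = \<kappa> (SOME y. y \<in> interior T)"

definition ktrace :: "(nat \<Rightarrow> pt set set) \<Rightarrow> (pt \<Rightarrow> real) \<Rightarrow> nat \<Rightarrow> pt \<Rightarrow> real" where
  "ktrace Tr \<kappa> i x = tri_val \<kappa> (tri_at Tr i x)"

definition seg_integral :: "pt set \<Rightarrow> (pt \<Rightarrow> real) \<Rightarrow> real" where
  "seg_integral E g =
     (if is_segment E then
        (let ab = (SOME ab. fst ab \<noteq> snd ab \<and> E = closed_segment (fst ab) (snd ab))
         in norm (snd ab - fst ab) *
            integral\<^sup>L (lebesgue_on {0..1}) (\<lambda>t. g (fst ab + t *\<^sub>R (snd ab - fst ab))))
      else 0)"

definition iface :: "(nat \<Rightarrow> pt set) \<Rightarrow> nat \<Rightarrow> nat \<Rightarrow> pt set" where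
  "iface Om i j = frontier (Om i) \<inter> frontier (Om j)"

text \<open>Integral over \<open>E_{i\<partial>} = \<partial>\<Omega>_i \<inter> \<partial>\<Omega>\<close> (a finite union of segments), computed
  along the fine boundary edges of \<open>Tr i\<close>.\<close>
definition bnd_integral ::
  "pt set \<Rightarrow> (nat \<Rightarrow> pt set) \<Rightarrow> (nat \<Rightarrow> pt set set) \<Rightarrow> nat \<Rightarrow> (pt \<Rightarrow> real) \<Rightarrow> real" where
  "bnd_integral Omega Om Tr i g =
     (\<Sum>e\<in>{e. \<exists>T\<in>Tr i. e \<in> tri_edges T \<and> e \<subseteq> frontier (Om i)}.
        seg_integral e (\<lambda>x. indicator (frontier Omega) x * g x))"

definition kap_ij :: "(nat \<Rightarrow> pt set set) \<Rightarrow> (pt \<Rightarrow> real) \<Rightarrow> nat \<Rightarrow> nat \<Rightarrow> pt \<Rightarrow> real" where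
  "kap_ij Tr \<kappa> i j x = 2 * ktrace Tr \<kappa> i x * ktrace Tr \<kappa> j x / (ktrace Tr \<kappa> i x + ktrace Tr \<kappa> j x)"

definition h_ij :: "(nat \<Rightarrow> pt set set) \<Rightarrow> nat \<Rightarrow> nat \<Rightarrow> real" where
  "h_ij Tr i j = 2 * mesh_size (Tr i) * mesh_size (Tr j) / (mesh_size (Tr i) + mesh_size (Tr j))"

definition a_loc :: "(nat \<Rightarrow> pt set) \<Rightarrow> (pt \<Rightarrow> real) \<Rightarrow> nat \<Rightarrow> (pt \<Rightarrow> real) \<Rightarrow> (pt \<Rightarrow> real) \<Rightarrow> real" where
  "a_loc Om \<kappa> i u v = integral\<^sup>L (lebesgue_on (Om i)) (\<lambda>x. \<kappa> x * (grad u x \<bullet> grad v x))"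

text \<open>\<open>s_i(u,v)\<close>; interior edges have \<open>l_ij = 2\<close>, the boundary edge \<open>l_{i\<partial>} = 1\<close>,
  \<open>\<kappa>_{i\<partial>} = \<kappa>_i\<close>, \<open>v_\<partial> = 0\<close>.\<close>
definition s_loc ::
  "pt set \<Rightarrow> nat \<Rightarrow> (nat \<Rightarrow> pt set) \<Rightarrow> (nat \<Rightarrow> pt set set) \<Rightarrow> (pt \<Rightarrow> real) \<Rightarrow> nat
   \<Rightarrow> (nat \<Rightarrow> pt \<Rightarrow> real) \<Rightarrow> (nat \<Rightarrow> pt \<Rightarrow> real) \<Rightarrow> real" where
  "s_loc Omega N Om Tr \<kappa> i u v =
     (\<Sum>j\<in>{1..N} - {i}. (1/2) * seg_integral (iface Om i j)
        (\<lambda>x. kap_ij Tr \<kappa> i j x *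
              (normal_deriv Tr i (u i) x * (v j x - v i x) + normal_deriv Tr i (v i) x * (u j x - u i x))))
     + bnd_integral Omega Om Tr i
        (\<lambda>x. ktrace Tr \<kappa> i x *
              (normal_deriv Tr i (u i) x * (0 - v i x) + normal_deriv Tr i (v i) x * (0 - u i x)))"

definition p_loc ::
  "pt set \<Rightarrow> nat \<Rightarrow> (nat \<Rightarrow> pt set) \<Rightarrow> (nat \<Rightarrow> pt set set) \<Rightarrow> (pt \<Rightarrow> real) \<Rightarrow> real \<Rightarrow> nat
   \<Rightarrow> (nat \<Rightarrow> pt \<Rightarrow> real) \<Rightarrow> (nat \<Rightarrow> pt \<Rightarrow> real) \<Rightarrow> real" where
  "p_loc Omega N Om Tr \<kappa> \<delta> i u v =
     (\<Sum>j\<in>{1..N} - {i}. (1/2) * (\<delta> / h_ij Tr i j) * seg_integral (iface Om i j)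
        (\<lambda>x. kap_ij Tr \<kappa> i j x * (u j x - u i x) * (v j x - v i x)))
     + (\<delta> / mesh_size (Tr i)) * bnd_integral Omega Om Tr i
        (\<lambda>x. ktrace Tr \<kappa> i x * (0 - u i x) * (0 - v i x))"

definition aDG ::
  "pt set \<Rightarrow> nat \<Rightarrow> (nat \<Rightarrow> pt set) \<Rightarrow> (nat \<Rightarrow> pt set set) \<Rightarrow> (pt \<Rightarrow> real) \<Rightarrow> real
   \<Rightarrow> (nat \<Rightarrow> pt \<Rightarrow> real) \<Rightarrow> (nat \<Rightarrow> pt \<Rightarrow> real) \<Rightarrow> real" where
  "aDG Omega N Om Tr \<kappa> \<delta> u v =
     (\<Sum>i\<in>{1..N}. a_loc Om \<kappa> i (u i) (v i) + s_loc Omega N Om Tr \<kappa> i u v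
                  + p_loc Omega N Om Tr \<kappa> \<delta> i u v)"

definition dh ::
  "pt set \<Rightarrow> nat \<Rightarrow> (nat \<Rightarrow> pt set) \<Rightarrow> (nat \<Rightarrow> pt set set) \<Rightarrow> (pt \<Rightarrow> real) \<Rightarrow> real
   \<Rightarrow> (nat \<Rightarrow> pt \<Rightarrow> real) \<Rightarrow> (nat \<Rightarrow> pt \<Rightarrow> real) \<Rightarrow> real" where
  "dh Omega N Om Tr \<kappa> \<delta> u v =
     (\<Sum>i\<in>{1..N}. a_loc Om \<kappa> i (u i) (v i) + p_loc Omega N Om Tr \<kappa> \<delta> i u v)"

definition f_form :: "nat \<Rightarrow> (nat \<Rightarrow> pt set) \<Rightarrow> (pt \<Rightarrow> real) \<Rightarrow> (nat \<Rightarrow> pt \<Rightarrow> real) \<Rightarrow> real" where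
  "f_form N Om f v = (\<Sum>i\<in>{1..N}. integral\<^sup>L (lebesgue_on (Om i)) (\<lambda>x. f x * v i x))"

definition m_loc :: "(nat \<Rightarrow> pt set) \<Rightarrow> (pt \<Rightarrow> real) \<Rightarrow> nat \<Rightarrow> (pt \<Rightarrow> real) \<Rightarrow> (pt \<Rightarrow> real) \<Rightarrow> real" where
  "m_loc Om \<kappa> i v z = integral\<^sup>L (lebesgue_on (Om i)) (\<lambda>x. \<kappa> x * v x * z x)"

definition mdelta_loc ::
  "pt set \<Rightarrow> nat \<Rightarrow> (nat \<Rightarrow> pt set) \<Rightarrow> (nat \<Rightarrow> pt set set) \<Rightarrow> (pt \<Rightarrow> real) \<Rightarrow> real \<Rightarrow> nat
   \<Rightarrow> (pt \<Rightarrow> real) \<Rightarrow> (pt \<Rightarrow> real) \<Rightarrow> real" where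
  "mdelta_loc Omega N Om Tr \<kappa> \<delta> i v z =
     (\<Sum>j\<in>{1..N} - {i}. (1/2) * (\<delta> / h_ij Tr i j) * seg_integral (iface Om i j)
        (\<lambda>x. kap_ij Tr \<kappa> i j x * v x * z x))
     + (\<delta> / mesh_size (Tr i)) * bnd_integral Omega Om Tr i (\<lambda>x. ktrace Tr \<kappa> i x * v x * z x)"

definition eigenpairs ::
  "pt set \<Rightarrow> nat \<Rightarrow> (nat \<Rightarrow> pt set) \<Rightarrow> (nat \<Rightarrow> pt set set) \<Rightarrow> (pt \<Rightarrow> real) \<Rightarrow> real \<Rightarrow> nat
   \<Rightarrow> (nat \<Rightarrow> real) \<Rightarrow> (nat \<Rightarrow> pt \<Rightarrow> real) \<Rightarrow> bool" where
  "eigenpairs Omega N Om Tr \<kappa> \<delta> i lam psi \<longleftrightarrow>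
     (let Ni = card (mesh_verts (Tr i)) in
       (\<forall>l\<in>{1..Ni}. psi l \<in> Xh_loc Om Tr i \<and>
          (\<forall>z\<in>Xh_loc Om Tr i. a_loc Om \<kappa> i (psi l) z =
              lam l * (m_loc Om \<kappa> i (psi l) z + mdelta_loc Omega N Om Tr \<kappa> \<delta> i (psi l) z))) \<and>
       0 \<le> lam 1 \<and> (\<forall>l\<in>{1..Ni}. \<forall>k\<in>{1..Ni}. l \<le> k \<longrightarrow> lam l \<le> lam k) \<and>
       (\<forall>l\<in>{1..Ni}. \<forall>k\<in>{1..Ni}.
          m_loc Om \<kappa> i (psi l) (psi k) + mdelta_loc Omega N Om Tr \<kappa> \<delta> i (psi l) (psi k)
            = (if l = k then 1 else 0)))"

definition XH2 :: "nat \<Rightarrow> (nat \<Rightarrow> nat \<Rightarrow> pt \<Rightarrow> real) \<Rightarrow> (nat \<Rightarrow> nat) \<Rightarrow> (nat \<Rightarrow> pt \<Rightarrow> real) set" where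
  "XH2 N psi L = {v. \<forall>i\<in>{1..N}. \<exists>c. v i = (\<lambda>x. \<Sum>l\<in>{1..L i}. c l * psi i l x)}"

end

theory Submission
  imports Defs
begin

text \<open>Write \<open>r\<close> for the part of \<open>u\<^sup>*\<^sub>h\<close> carried by the discarded eigenfunctions. By Galerkin orthogonality and
  the equivalence of \<open>a\<^sup>D\<^sup>G\<^sub>h\<close> with \<open>d\<^sub>h\<close>, the error is bounded by \<open>\<gamma>\<^sub>1 / \<gamma>\<^sub>0\<close> times \<open>d\<^sub>h(r, r)\<close>. Its \<open>a\<^sub>i\<close> part is
  the sum of the \<open>\<lambda>\<^sub>l c\<^sub>l\<^sup>2\<close>; its penalty part is at most four times the boundary mass
  \<open>m\<^sub>i\<^sup>\<delta>(r, r) \<le> \<Sum> c\<^sub>l\<^sup>2\<close>, and each discarded eigenvalue is at least the minimum in the statement.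
  The eigenfunctions span \<open>X\<^sub>h(\<Omega>\<^sub>i)\<close> because a function of that space is determined by its values
  at the mesh vertices.\<close>

section \<open>Linear algebra on spaces of functions\<close>

text \<open>Most of the work goes into making the forms bilinear. The integral of a non-integrable
  function is 0, so additivity of each form has to be earned by integrability of its integrand. Over
  a subdomain this follows from continuity up to a null set on each triangle. Along edges, the
  traces of \<kappa> and the normal derivatives are built from \<open>SOME\<close> and
  \<open>THE\<close>, and they are tamed by the finiteness of the set of faces of the mesh. The
  competitor for the Galerkin solution is the truncation \<open>w\<close> of the eigenfunction
  expansion of \<open>uh\<close>. The difference \<open>z\<close> of \<open>ums\<close> and
  \<open>w\<close> lies in the coarse space, so the error \<open>e\<close> is orthogonal to
  \<open>z\<close>, and \<open>r = e + z\<close>. As the DG form is symmetric, Pythagoras gives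
  A(r,r) = A(e,e) + A(z,z). Dropping A(z,z) and using the equivalence with \<open>dh\<close> once on
  each side yields the constant \<gamma>1 / \<gamma>0, with no Cauchy-Schwarz estimate.\<close>

lemma nontrivial_dependence:
  fixes f :: "'i \<Rightarrow> 'a \<Rightarrow> real"
  assumes "finite V" "finite I" "card V < card I"
  shows "\<exists>c. (\<exists>l\<in>I. c l \<noteq> 0) \<and> (\<forall>x\<in>V. (\<Sum>l\<in>I. c l * f l x) = 0)"
  using assms
proof (induction V arbitrary: I f rule: finite_induct)
  case empty
  then have "I \<noteq> {}" by auto
  then show ?case by (intro exI[of _ "\<lambda>_. 1"]) auto
next
  case (insert x V)
  show ?case
  proof (cases "\<forall>l\<in>I. f l x = 0")
    case True
    obtain c where "\<exists>l\<in>I. c l \<noteq> 0" "\<forall>x\<in>V. (\<Sum>l\<in>I. c l * f l x) = 0"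
      using insert.IH[of I f] insert.prems insert.hyps by auto
    then show ?thesis using True by (intro exI[of _ c]) auto
  next
    case False
    then obtain k where k: "k \<in> I" "f k x \<noteq> 0" by blast
    \<comment> \<open>Gaussian elimination with pivot \<open>f k x\<close>: every \<open>g l\<close>
      vanishes at \<open>x\<close>, so only the points of \<open>V\<close> remain.\<close>
    define g where "g l y = f l y - f l x / f k x * f k y" for l y
    have "card V < card (I - {k})" "finite (I - {k})"
      using insert.prems insert.hyps k by auto
    then obtain c where c: "\<exists>l\<in>I - {k}. c l \<noteq> 0"
      and c0: "\<forall>y\<in>V. (\<Sum>l\<in>I - {k}. c l * g l y) = 0"
      using insert.IH[of "I - {k}" g] by auto
    \<comment> \<open>\<open>d k\<close> collects the multiples of \<open>f k\<close> that were
      subtracted in the functions \<open>g l\<close>.\<close>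
    define d where "d l = (if l = k then - (\<Sum>m\<in>I - {k}. c m * f m x / f k x) else c l)" for l
    have d_sum: "(\<Sum>l\<in>I. d l * f l y) = (\<Sum>l\<in>I - {k}. c l * g l y)" for y
    proof -
      have "(\<Sum>l\<in>I. d l * f l y) = d k * f k y + (\<Sum>l\<in>I - {k}. c l * f l y)"
        using insert.prems k by (subst sum.remove[of I k]) (auto simp: d_def intro!: sum.cong)
      also have "\<dots> = (\<Sum>l\<in>I - {k}. c l * g l y)"
        by (simp add: d_def g_def right_diff_distrib sum_subtractf sum_distrib_right mult.assoc)
      finally show ?thesis .
    qed
    have "(\<Sum>l\<in>I - {k}. c l * g l x) = 0"
      using k by (simp add: g_def)
    then have "\<forall>y\<in>insert x V. (\<Sum>l\<in>I. d l * f l y) = 0"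
      using c0 d_sum by auto
    moreover have "\<exists>l\<in>I. d l \<noteq> 0"
      using c by (auto simp: d_def)
    ultimately show ?thesis by blast
  qed
qed

text \<open>Linearity is asked for only on the carrier \<open>W\<close>, because the integral forms
  are additive only where their integrands are integrable. The single combination u + c v packages
  additivity and homogeneity; symmetry supplies the second argument.\<close>

locale sym_bilinear_on =
  fixes W :: "('a \<Rightarrow> real) set" and B :: "('a \<Rightarrow> real) \<Rightarrow> ('a \<Rightarrow> real) \<Rightarrow> real"
  assumes zero_mem: "(\<lambda>x. 0) \<in> W"
    and comb_mem: "\<And>u v c. u \<in> W \<Longrightarrow> v \<in> W \<Longrightarrow> (\<lambda>x. u x + c * v x) \<in> W"
    and comb_left: "\<And>u v z c. u \<in> W \<Longrightarrow> v \<in> W \<Longrightarrow> z \<in> W \<Longrightarrow>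
        B (\<lambda>x. u x + c * v x) z = B u z + c * B v z"
    and commute: "\<And>u v. u \<in> W \<Longrightarrow> v \<in> W \<Longrightarrow> B u v = B v u"
begin

lemma zero_left: "z \<in> W \<Longrightarrow> B (\<lambda>x. 0) z = 0"
  using comb_left[of "\<lambda>x. 0" "\<lambda>x. 0" z 1] zero_mem by simp

lemma sum_mem:
  assumes "\<And>l. l \<in> A \<Longrightarrow> \<psi> l \<in> W"
  shows "(\<lambda>x. \<Sum>l\<in>A. c l * \<psi> l x) \<in> W"
  using assms
proof (induction A rule: infinite_finite_induct)
  case (insert k A)
  then have "(\<lambda>x. (\<Sum>l\<in>A. c l * \<psi> l x) + c k * \<psi> k x) \<in> W"
    by (intro comb_mem) auto
  then show ?case using insert by (simp add: add.commute)
qed (auto simp: zero_mem)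

lemma sum_left:
  assumes "\<And>l. l \<in> A \<Longrightarrow> \<psi> l \<in> W" and "z \<in> W"
  shows "B (\<lambda>x. \<Sum>l\<in>A. c l * \<psi> l x) z = (\<Sum>l\<in>A. c l * B (\<psi> l) z)"
  using assms
proof (induction A rule: infinite_finite_induct)
  case (insert k A)
  then have "B (\<lambda>x. (\<Sum>l\<in>A. c l * \<psi> l x) + c k * \<psi> k x) z
      = B (\<lambda>x. \<Sum>l\<in>A. c l * \<psi> l x) z + c k * B (\<psi> k) z"
    by (intro comb_left sum_mem) auto
  then show ?case using insert by (simp add: add.commute)
qed (auto simp: zero_left)

text \<open>Parseval identity for a \<open>B\<close>-orthogonal family. It serves the mass form with
  \<open>\<mu> l = 1\<close> and the stiffness form with the eigenvalues.\<close>

lemma sum_diagonal: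
  assumes fin: "finite A" and mem: "\<And>l. l \<in> A \<Longrightarrow> \<psi> l \<in> W"
    and diag: "\<And>l k. l \<in> A \<Longrightarrow> k \<in> A \<Longrightarrow> B (\<psi> l) (\<psi> k) = (if l = k then \<mu> l else 0)"
  shows "B (\<lambda>x. \<Sum>l\<in>A. c l * \<psi> l x) (\<lambda>x. \<Sum>l\<in>A. c l * \<psi> l x) = (\<Sum>l\<in>A. \<mu> l * (c l)\<^sup>2)"
proof -
  have sm: "(\<lambda>x. \<Sum>l\<in>A. c l * \<psi> l x) \<in> W" by (rule sum_mem[OF mem])
  have "B (\<psi> l) (\<lambda>x. \<Sum>l\<in>A. c l * \<psi> l x) = \<mu> l * c l" if l: "l \<in> A" for l
  proof -
    have "B (\<psi> l) (\<lambda>x. \<Sum>l\<in>A. c l * \<psi> l x) = (\<Sum>k\<in>A. c k * B (\<psi> k) (\<psi> l))"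
      using commute[OF mem[OF l] sm] sum_left[OF mem mem[OF l]] by simp
    also have "\<dots> = (\<Sum>k\<in>A. if k = l then c k * \<mu> k else 0)"
      using diag l by (intro sum.cong) auto
    finally show ?thesis using fin l by simp
  qed
  then show ?thesis
    by (subst sum_left[OF mem sm]) (auto intro!: sum.cong simp: power2_eq_square)
qed

end

section \<open>Integrals along segments\<close>

text \<open>Unlike integrability, this class is closed under products. Borel rather than Lebesgue
  measurability is essential: a segment is null in the plane, so Lebesgue measurability there would
  say nothing about the composition with a parametrisation.\<close>

definition bdd_borel_on :: "pt set \<Rightarrow> (pt \<Rightarrow> real) \<Rightarrow> bool" where
  "bdd_borel_on E g \<longleftrightarrow> bounded (g ` E) \<and> g \<in> borel_measurable (restrict_space borel E)"

lemma bdd_borel_on_subset: "bdd_borel_on E g \<Longrightarrow> F \<subseteq> E \<Longrightarrow> bdd_borel_on F g"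
  unfolding bdd_borel_on_def
  by (intro conjI) (auto elim!: bounded_subset intro: measurable_restrict_mono)

lemma bdd_borel_on_mult:
  assumes "bdd_borel_on E f" "bdd_borel_on E g"
  shows "bdd_borel_on E (\<lambda>x. f x * g x)"
proof -
  obtain M N where M: "\<And>x. x \<in> E \<Longrightarrow> norm (f x) \<le> M" and N: "\<And>x. x \<in> E \<Longrightarrow> norm (g x) \<le> N"
    using assms unfolding bdd_borel_on_def bounded_iff by auto
  have "norm (f x * g x) \<le> M * N" if "x \<in> E" for x
    using mult_mono[OF M[OF that] N[OF that]] order_trans[OF norm_ge_zero M[OF that]]
    by (simp add: abs_mult)
  then have "bounded ((\<lambda>x. f x * g x) ` E)"
    by (intro boundedI[of _ "M * N"]) auto
  moreover have "(\<lambda>x. f x * g x) \<in> borel_measurable (restrict_space borel E)"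
    using assms by (intro borel_measurable_times) (auto simp: bdd_borel_on_def)
  ultimately show ?thesis by (simp add: bdd_borel_on_def)
qed

lemma bdd_borel_on_add:
  assumes "bdd_borel_on E f" "bdd_borel_on E g"
  shows "bdd_borel_on E (\<lambda>x. f x + g x)"
  using assms unfolding bdd_borel_on_def by (intro conjI bounded_plus_comp borel_measurable_add) auto

lemma bdd_borel_on_diff:
  assumes "bdd_borel_on E f" "bdd_borel_on E g"
  shows "bdd_borel_on E (\<lambda>x. f x - g x)"
  using assms unfolding bdd_borel_on_def by (intro conjI bounded_minus_comp borel_measurable_diff) auto

lemma bdd_borel_on_const: "bdd_borel_on E (\<lambda>x. c)"
  unfolding bdd_borel_on_def by (auto intro: boundedI[of _ "\<bar>c\<bar>"])

lemma bdd_borel_on_continuous: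
  assumes "continuous_on E g" "compact E"
  shows "bdd_borel_on E g"
  using assms unfolding bdd_borel_on_def
  by (intro conjI borel_measurable_continuous_on_restrict compact_imp_bounded compact_continuous_image)

lemma bdd_borel_on_indicator: "closed S \<Longrightarrow> bdd_borel_on E (indicator S)"
  unfolding bdd_borel_on_def
  by (intro conjI boundedI[of _ 1] measurable_restrict_space1) (auto simp: indicator_def)

text \<open>The \<open>SOME\<close> and \<open>THE\<close> terms in \<open>tri_at\<close> and \<open>tri_normal\<close> depend on \<open>x\<close> only through the finite
  set of closed faces containing \<open>x\<close>, so they are simple functions along a segment even at
  points where they are not mathematically meaningful.\<close>

lemma bdd_borel_on_signature:
  assumes fin: "finite \<S>" and cl: "\<And>S. S \<in> \<S> \<Longrightarrow> closed S" and "closed E"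
    and dep: "\<And>x y. x \<in> E \<Longrightarrow> y \<in> E \<Longrightarrow> (\<And>S. S \<in> \<S> \<Longrightarrow> x \<in> S \<longleftrightarrow> y \<in> S) \<Longrightarrow> g x = g y"
  shows "bdd_borel_on E g"
proof -
  define \<sigma> where "\<sigma> x = {S \<in> \<S>. x \<in> S}" for x
  \<comment> \<open>\<open>g\<close> factors through the signature \<open>\<sigma>\<close>:
    \<open>h\<close> evaluates it at any representative. A signature not attained on
    \<open>E\<close> receives an arbitrary value, which is harmless since only finitely many
    signatures exist.\<close>
  define h where "h s = g (SOME x. x \<in> E \<and> \<sigma> x = s)" for s
  have gh: "g x = h (\<sigma> x)" if "x \<in> E" for x
  proof -
    have "(SOME y. y \<in> E \<and> \<sigma> y = \<sigma> x) \<in> E \<and> \<sigma> (SOME y. y \<in> E \<and> \<sigma> y = \<sigma> x) = \<sigma> x"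
      by (rule someI[of _ x]) (use that in auto)
    then show ?thesis
      unfolding h_def using that by (intro dep) (auto simp: \<sigma>_def)
  qed
  have "\<sigma> -` {s} \<in> sets borel" if "s \<in> Pow \<S>" for s
  proof -
    have "\<sigma> -` {s} = (\<Inter>S\<in>s. S) \<inter> (\<Inter>S\<in>\<S> - s. - S)"
      using that by (auto simp: \<sigma>_def)
    moreover have "closed (\<Inter>S\<in>s. S)" using that cl by auto
    moreover have "open (\<Inter>S\<in>\<S> - s. - S)" using fin cl by (intro open_INT) auto
    ultimately show ?thesis by auto
  qed
  then have "\<sigma> \<in> borel \<rightarrow>\<^sub>M count_space (Pow \<S>)"
    using fin by (subst measurable_count_space_eq2) (auto simp: \<sigma>_def)
  then have "\<sigma> \<in> restrict_space borel E \<rightarrow>\<^sub>M count_space (Pow \<S>)"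
    by (rule measurable_restrict_space1)
  then have "(\<lambda>x. h (\<sigma> x)) \<in> borel_measurable (restrict_space borel E)"
    by (rule measurable_compose) auto
  then have "g \<in> borel_measurable (restrict_space borel E)"
    by (subst measurable_cong[of _ g "\<lambda>x. h (\<sigma> x)"]) (auto simp: gh space_restrict_space)
  moreover have "g ` E \<subseteq> h ` Pow \<S>"
    using gh by (auto simp: \<sigma>_def)
  then have "bounded (g ` E)"
    using fin by (intro bounded_subset[OF finite_imp_bounded[of "h ` Pow \<S>"]]) auto
  ultimately show ?thesis by (simp add: bdd_borel_on_def)
qed

lemma segment_point_mem:
  fixes a b :: "'a::real_vector"
  assumes "t \<in> {0..1}"
  shows "a + t *\<^sub>R (b - a) \<in> closed_segment a b"
  unfolding in_segment by (rule exI[of _ t]) (use assms in \<open>simp add: algebra_simps\<close>)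

lemma segment_integrable:
  assumes "bdd_borel_on (closed_segment a b) g"
  shows "integrable (lebesgue_on {0..1::real}) (\<lambda>t. g (a + t *\<^sub>R (b - a)))"
proof -
  interpret finite_measure "lebesgue_on {0..1::real}"
    by (intro finite_measureI) (simp add: emeasure_restrict_space space_restrict_space)
  have "(\<lambda>t. a + t *\<^sub>R (b - a)) \<in> lebesgue_on {0..1} \<rightarrow>\<^sub>M borel"
    by (intro measurable_restrict_space1 measurable_completion) simp
  then have param: "(\<lambda>t. a + t *\<^sub>R (b - a)) \<in> lebesgue_on {0..1} \<rightarrow>\<^sub>M restrict_space borel (closed_segment a b)"
    by (rule measurable_restrict_space2[rotated]) (simp add: space_restrict_space segment_point_mem)
  have meas: "(\<lambda>t. g (a + t *\<^sub>R (b - a))) \<in> borel_measurable (lebesgue_on {0..1})"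
    by (rule measurable_compose[OF param]) (use assms in \<open>simp add: bdd_borel_on_def\<close>)
  obtain M where M: "\<And>x. x \<in> closed_segment a b \<Longrightarrow> norm (g x) \<le> M"
    using assms unfolding bdd_borel_on_def bounded_iff by auto
  have "AE t in lebesgue_on {0..1}. norm (g (a + t *\<^sub>R (b - a))) \<le> M"
    using M[OF segment_point_mem] by (intro AE_I2) (simp add: space_restrict_space)
  then show ?thesis
    using meas by (rule integrable_const_bound)
qed

text \<open>The endpoints chosen by \<open>SOME\<close> do not depend on the integrand, so all
  integrands on \<open>E\<close> can be compared along one parametrisation.\<close>

lemma is_segment_obtain:
  assumes "is_segment E"
  obtains a b where "E = closed_segment a b"
    "\<And>g. seg_integral E g = norm (b - a) *
        integral\<^sup>L (lebesgue_on {0..1}) (\<lambda>t. g (a + t *\<^sub>R (b - a)))"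
proof -
  define ab where "ab = (SOME ab. fst ab \<noteq> snd ab \<and> E = closed_segment (fst ab) (snd ab))"
  have "\<exists>ab. fst ab \<noteq> snd ab \<and> E = closed_segment (fst ab) (snd ab)"
    using assms by (auto simp: is_segment_def)
  then have "E = closed_segment (fst ab) (snd ab)"
    unfolding ab_def by (rule someI2_ex) auto
  then show ?thesis
    using assms that[of "fst ab" "snd ab"] by (simp add: seg_integral_def ab_def Let_def)
qed

lemma seg_integral_cong:
  assumes "\<And>x. x \<in> E \<Longrightarrow> g x = h x"
  shows "seg_integral E g = seg_integral E h"
proof (cases "is_segment E")
  case True
  then obtain a b where "E = closed_segment a b"
    "\<And>g. seg_integral E g = norm (b - a) *
        integral\<^sup>L (lebesgue_on {0..1}) (\<lambda>t. g (a + t *\<^sub>R (b - a)))"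
    by (rule is_segment_obtain) blast
  then show ?thesis
    using assms segment_point_mem[where a = a and b = b]
    by (auto simp: space_restrict_space intro!: Bochner_Integration.integral_cong)
qed (simp add: seg_integral_def)

text \<open>An interface may also be empty or a single point; then \<open>seg_integral\<close> is 0
  by definition and the identity is trivial.\<close>

lemma seg_integral_linear:
  assumes g: "bdd_borel_on E g" and h: "bdd_borel_on E h"
    and k: "\<And>x. x \<in> E \<Longrightarrow> k x = g x + c * h x"
  shows "seg_integral E k = seg_integral E g + c * seg_integral E h"
proof (cases "is_segment E")
  case True
  then obtain a b where ab: "E = closed_segment a b"
    "\<And>g. seg_integral E g = norm (b - a) *
        integral\<^sup>L (lebesgue_on {0..1}) (\<lambda>t. g (a + t *\<^sub>R (b - a)))"
    by (rule is_segment_obtain) blast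
  have "seg_integral E k = seg_integral E (\<lambda>x. g x + c * h x)"
    using k by (rule seg_integral_cong)
  also have "\<dots> = seg_integral E g + c * seg_integral E h"
    using segment_integrable[of a b g] segment_integrable[of a b h] g h
    unfolding ab(2) by (simp add: ab(1) distrib_left)
  finally show ?thesis .
qed (simp add: seg_integral_def)

lemma seg_integral_mono:
  assumes g: "bdd_borel_on E g" and h: "bdd_borel_on E h"
    and le: "\<And>x. x \<in> E \<Longrightarrow> g x \<le> h x"
  shows "seg_integral E g \<le> seg_integral E h"
proof (cases "is_segment E")
  case True
  then obtain a b where ab: "E = closed_segment a b"
    "\<And>g. seg_integral E g = norm (b - a) *
        integral\<^sup>L (lebesgue_on {0..1}) (\<lambda>t. g (a + t *\<^sub>R (b - a)))"
    by (rule is_segment_obtain) blast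
  then show ?thesis
    using segment_integrable[of a b g] segment_integrable[of a b h] g h le segment_point_mem[where a = a and b = b]
    by (auto simp: space_restrict_space intro!: mult_left_mono integral_mono)
qed (simp add: seg_integral_def)

lemma seg_integral_nonneg:
  assumes "\<And>x. x \<in> E \<Longrightarrow> 0 \<le> g x"
  shows "0 \<le> seg_integral E g"
proof (cases "is_segment E")
  case True
  then obtain a b where "E = closed_segment a b"
    "\<And>g. seg_integral E g = norm (b - a) *
        integral\<^sup>L (lebesgue_on {0..1}) (\<lambda>t. g (a + t *\<^sub>R (b - a)))"
    by (rule is_segment_obtain) blast
  then show ?thesis
    using assms segment_point_mem[where a = a and b = b]
    by (auto simp: space_restrict_space intro!: mult_nonneg_nonneg Bochner_Integration.integral_nonneg)
qed (simp add: seg_integral_def)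

lemma bnd_integral_linear:
  assumes g: "bdd_borel_on (frontier (Om i)) g" and h: "bdd_borel_on (frontier (Om i)) h"
    and k: "\<And>x. x \<in> frontier (Om i) \<Longrightarrow> k x = g x + c * h x"
  shows "bnd_integral Omega Om Tr i k = bnd_integral Omega Om Tr i g + c * bnd_integral Omega Om Tr i h"
  unfolding bnd_integral_def sum_distrib_left sum.distrib[symmetric]
proof (rule sum.cong[OF refl], clarify)
  fix e assume e: "e \<subseteq> frontier (Om i)"
  have "bdd_borel_on e (\<lambda>x. indicator (frontier Omega) x * f x)"
    if "bdd_borel_on (frontier (Om i)) f" for f
    using bdd_borel_on_mult[OF bdd_borel_on_indicator bdd_borel_on_subset[OF that e]] by simp
  then show "seg_integral e (\<lambda>x. indicator (frontier Omega) x * k x) =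
      seg_integral e (\<lambda>x. indicator (frontier Omega) x * g x) +
      c * seg_integral e (\<lambda>x. indicator (frontier Omega) x * h x)"
    using g h k e by (intro seg_integral_linear) (auto simp: algebra_simps)
qed

lemma bnd_integral_nonneg:
  assumes "\<And>x. x \<in> frontier (Om i) \<Longrightarrow> 0 \<le> g x"
  shows "0 \<le> bnd_integral Omega Om Tr i g"
  unfolding bnd_integral_def
  by (intro sum_nonneg seg_integral_nonneg) (use assms in \<open>auto simp: indicator_def\<close>)

section \<open>Triangles\<close>

text \<open>The barycentre is an interior point. Since \<open>verts\<close> consists of the extreme
  points, the last fact is the Krein-Milman theorem in finite dimension.\<close>

lemma is_triD:
  assumes "is_tri T"
  shows "compact T" "convex T" "interior T \<noteq> {}" "finite (verts T)" "T = convex hull verts T"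
proof -
  obtain a b c where nc: "\<not> collinear {a, b, c}" and T: "T = convex hull {a, b, c}"
    using assms by (auto simp: is_tri_def)
  show c: "compact T" and v: "convex T"
    by (auto simp: T finite_imp_compact_convex_hull)
  have "(1/3) *\<^sub>R a + (1/3) *\<^sub>R b + (1/3) *\<^sub>R c \<in> interior T"
    unfolding T interior_convex_hull_3_minimal[OF nc, simplified]
    by (auto intro!: exI[of _ "1/3::real"])
  then show "interior T \<noteq> {}" by auto
  show "finite (verts T)"
    using finite_subset[OF extreme_points_of_convex_hull[of "{a, b, c}"]] by (simp add: verts_def T)
  show "T = convex hull verts T"
    using Krein_Milman_Minkowski[OF c v] by (simp add: verts_def)
qed

lemma affine_on_has_derivative:
  assumes "x \<in> interior T" "\<And>y. y \<in> T \<Longrightarrow> u y = c + g \<bullet> y"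
  shows "(u has_derivative (\<lambda>h. g \<bullet> h)) (at x)"
proof (rule has_derivative_transform_within_open[of "\<lambda>y. c + g \<bullet> y" _ x UNIV "interior T"])
  show "((\<lambda>y. c + g \<bullet> y) has_derivative (\<lambda>h. g \<bullet> h)) (at x)"
    by (auto intro!: derivative_eq_intros)
qed (use assms interior_subset[of T] in \<open>auto simp: subset_iff\<close>)

lemma inner_derivative_unique:
  fixes g g' :: "'a::real_inner"
  assumes "(u has_derivative (\<lambda>h. g \<bullet> h)) (at x)" "(u has_derivative (\<lambda>h. g' \<bullet> h)) (at x)"
  shows "g = g'"
  using has_derivative_unique[OF assms] by (metis inner_commute vector_eq_ldot)

text \<open>Uniqueness for the \<open>THE\<close> comes from uniqueness of the derivative at an
  interior point of \<open>T\<close>.\<close>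

lemma tri_grad_eq:
  assumes "interior T \<noteq> {}" "\<And>y. y \<in> T \<Longrightarrow> u y = c + g \<bullet> y"
  shows "tri_grad T u = g"
  unfolding tri_grad_def
proof (rule the_equality)
  fix g' assume "\<exists>c. \<forall>y\<in>T. u y = c + g' \<bullet> y"
  then obtain c' where "\<And>y. y \<in> T \<Longrightarrow> u y = c' + g' \<bullet> y" by auto
  moreover obtain x where "x \<in> interior T" using assms by auto
  ultimately show "g' = g"
    using affine_on_has_derivative[of x T u] assms(2) by (blast intro: inner_derivative_unique)
qed (use assms in auto)

lemma grad_eq:
  assumes "(u has_derivative (\<lambda>h. g \<bullet> h)) (at x)"
  shows "grad u x = g"
  unfolding grad_def using assms inner_derivative_unique by (intro the_equality) auto

text \<open>A linear functional attains its maximum over the hull at \<open>x\<close> iff \<open>x\<close> lies in the hull of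
  the maximising vertices.\<close>

lemma support_direction_transfer:
  fixes n :: "'a::real_inner"
  assumes fin: "finite V" and x: "x \<in> convex hull V"
    and tr: "\<And>V'. V' \<subseteq> V \<Longrightarrow> x \<in> convex hull V' \<Longrightarrow> y \<in> convex hull V'"
    and n: "\<And>z. z \<in> convex hull V \<Longrightarrow> n \<bullet> (z - x) \<le> 0"
    and z: "z \<in> convex hull V"
  shows "n \<bullet> (z - y) \<le> 0"
proof -
  define V' where "V' = {v \<in> V. n \<bullet> v = n \<bullet> x}"
  obtain w where w: "\<And>v. v \<in> V \<Longrightarrow> 0 \<le> w v" "sum w V = 1" "(\<Sum>v\<in>V. w v *\<^sub>R v) = x"
    using x fin by (auto simp: convex_hull_finite)
  have le: "n \<bullet> v \<le> n \<bullet> x" if "v \<in> V" for v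
    using n[of v] that by (simp add: hull_inc inner_diff_right)
  have "n \<bullet> x = n \<bullet> (\<Sum>v\<in>V. w v *\<^sub>R v)" by (simp add: w)
  also have "\<dots> = (\<Sum>v\<in>V. w v * (n \<bullet> v))" by (simp add: inner_sum_right)
  finally have "(\<Sum>v\<in>V. w v * (n \<bullet> x - n \<bullet> v)) = 0"
    using w(2) by (simp add: right_diff_distrib sum_subtractf flip: sum_distrib_right)
  \<comment> \<open>The weighted gaps are nonnegative and sum to zero, so the weights of
    \<open>x\<close> are supported on the maximising vertices \<open>V'\<close>.\<close>
  then have "\<forall>v\<in>V. w v * (n \<bullet> x - n \<bullet> v) = 0"
    using fin w le by (subst (asm) sum_nonneg_eq_0_iff) auto
  then have w0: "w v = 0" if "v \<in> V - V'" for v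
    using that by (auto simp: V'_def)
  have sub: "V' \<subseteq> V" by (auto simp: V'_def)
  have "sum w V' = sum w V" "(\<Sum>v\<in>V'. w v *\<^sub>R v) = (\<Sum>v\<in>V. w v *\<^sub>R v)"
    using w0 by (auto intro!: sum.mono_neutral_left[OF fin sub])
  then have "sum w V' = 1" "(\<Sum>v\<in>V'. w v *\<^sub>R v) = x"
    using w by auto
  then have "x \<in> convex hull V'"
    using w(1) sub finite_subset[OF sub fin] by (auto simp: convex_hull_finite intro!: exI[of _ w])
  then have "y \<in> convex hull V'" using tr sub by auto
  then obtain w' where "sum w' V' = 1" "(\<Sum>v\<in>V'. w' v *\<^sub>R v) = y"
    using finite_subset[OF sub fin] by (auto simp: convex_hull_finite)
  then have "n \<bullet> y = (\<Sum>v\<in>V'. w' v * (n \<bullet> v))"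
    by (auto simp: inner_sum_right)
  also have "\<dots> = (\<Sum>v\<in>V'. w' v * (n \<bullet> x))"
    by (auto simp: V'_def)
  also have "\<dots> = n \<bullet> x"
    using \<open>sum w' V' = 1\<close> by (simp flip: sum_distrib_right)
  finally show ?thesis using n[OF z] by (simp add: inner_diff_right)
qed

section \<open>The discrete spaces and forms\<close>

text \<open>All vertex subsets are taken, so triangles, edges and vertices all occur. Membership of
  a point in these sets decides both which triangles contain it and which directions support them
  there.\<close>

definition mesh_faces :: "pt set set \<Rightarrow> pt set set" where
  "mesh_faces Tr = (\<Union>T\<in>Tr. (\<lambda>V. convex hull V) ` Pow (verts T))"

locale dg_decomposition =
  fixes Omega :: "pt set" and N :: nat and Om :: "nat \<Rightarrow> pt set"
    and Tr :: "nat \<Rightarrow> pt set set" and \<kappa> :: "pt \<Rightarrow> real"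
  assumes setting: "dg_setting Omega N Om Tr \<kappa>"
begin

abbreviation "X i \<equiv> Xh_loc Om Tr i"

lemma N_pos: "1 \<le> N"
  using setting by (simp add: dg_setting_def)

section \<open>One subdomain: its mesh, gradients and finite element space\<close>

context
  fixes i assumes i: "i \<in> {1..N}"
begin

lemma subdomain_open: "open (Om i)"
  using setting i by (auto simp: dg_setting_def polygonal_domain_def)

lemma subdomain_bounded: "bounded (Om i)"
  using setting i by (auto simp: dg_setting_def polygonal_domain_def)

lemma subdomain_subset: "Om i \<subseteq> Omega"
  using setting i unfolding dg_setting_def by blast

lemma coefficient_pos: "x \<in> Om i \<Longrightarrow> 0 < \<kappa> x"
  using setting subdomain_subset unfolding dg_setting_def by blast

lemma mesh: "finite (Tr i)" "Tr i \<noteq> {}" "\<Union>(Tr i) = closure (Om i)"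
  using setting i by (auto simp: dg_setting_def conforming_triangulation_def)

lemma mesh_triangle: "T \<in> Tr i \<Longrightarrow> is_tri T"
  using setting i by (auto simp: dg_setting_def conforming_triangulation_def)

lemma triangle_subset: "T \<in> Tr i \<Longrightarrow> T \<subseteq> closure (Om i)"
  using mesh by auto

lemma coefficient_const:
  assumes "T \<in> Tr i"
  obtains k where "k > 0" "\<And>x. x \<in> interior T \<Longrightarrow> \<kappa> x = k"
proof -
  have "\<exists>k>0. \<forall>x\<in>interior T. \<kappa> x = k"
    using setting i assms unfolding dg_setting_def by blast
  then show ?thesis using that by blast
qed

lemma finite_mesh_verts: "finite (mesh_verts (Tr i))"
  unfolding mesh_verts_def using mesh(1) is_triD(4) mesh_triangle by auto

lemma mesh_size_nonneg: "0 \<le> mesh_size (Tr i)"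
proof -
  obtain T where T: "T \<in> Tr i" using mesh by auto
  then have "0 \<le> diameter T"
    using is_triD(1)[OF mesh_triangle, THEN compact_imp_bounded] by (intro diameter_ge_0) auto
  also have "\<dots> \<le> mesh_size (Tr i)"
    unfolding mesh_size_def using T mesh by (intro Max_ge) auto
  finally show ?thesis .
qed

lemma Xh_loc_affine:
  assumes "u \<in> X i" "T \<in> Tr i"
  obtains c where "\<And>y. y \<in> T \<Longrightarrow> u y = c + tri_grad T u \<bullet> y"
proof -
  obtain c g where cg: "\<And>y. y \<in> T \<Longrightarrow> u y = c + g \<bullet> y"
    using assms unfolding Xh_loc_def by blast
  then have "tri_grad T u = g"
    using is_triD(3)[OF mesh_triangle[OF assms(2)]] by (intro tri_grad_eq) auto
  then show ?thesis using cg that by auto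
qed

lemma grad_eq_tri_grad:
  assumes "u \<in> X i" "T \<in> Tr i" "x \<in> interior T"
  shows "grad u x = tri_grad T u"
  by (rule Xh_loc_affine[OF assms(1,2)]) (rule grad_eq[OF affine_on_has_derivative[OF assms(3)]])

lemma Xh_loc_comb:
  assumes u: "u \<in> X i" and v: "v \<in> X i"
  shows "(\<lambda>x. u x + c * v x) \<in> X i"
proof -
  have "\<exists>d g. \<forall>y\<in>T. u y + c * v y = d + g \<bullet> y" if T: "T \<in> Tr i" for T
  proof -
    obtain a where "\<And>y. y \<in> T \<Longrightarrow> u y = a + tri_grad T u \<bullet> y"
      using Xh_loc_affine[OF u T] by blast
    moreover obtain b where "\<And>y. y \<in> T \<Longrightarrow> v y = b + tri_grad T v \<bullet> y"
      using Xh_loc_affine[OF v T] by blast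
    ultimately show ?thesis
      by (intro exI[of _ "a + c * b"] exI[of _ "tri_grad T u + c *\<^sub>R tri_grad T v"])
        (simp add: algebra_simps inner_add_left)
  qed
  then show ?thesis
    using u v by (auto simp: Xh_loc_def intro!: continuous_intros)
qed

lemma tri_grad_comb:
  assumes u: "u \<in> X i" and v: "v \<in> X i" and T: "T \<in> Tr i"
  shows "tri_grad T (\<lambda>x. u x + c * v x) = tri_grad T u + c *\<^sub>R tri_grad T v"
proof -
  obtain a where "\<And>y. y \<in> T \<Longrightarrow> u y = a + tri_grad T u \<bullet> y"
    using Xh_loc_affine[OF u T] by blast
  moreover obtain b where "\<And>y. y \<in> T \<Longrightarrow> v y = b + tri_grad T v \<bullet> y"
    using Xh_loc_affine[OF v T] by blast
  ultimately show ?thesis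
    using is_triD(3)[OF mesh_triangle[OF T]]
    by (intro tri_grad_eq[where c = "a + c * b"]) (auto simp: algebra_simps inner_add_left)
qed

lemma Xh_loc_zero: "(\<lambda>x. 0) \<in> X i"
  by (auto simp: Xh_loc_def intro!: exI[of _ 0])

text \<open>On a triangle, an affine function that vanishes at the vertices vanishes on their convex
  hull; off the closure the convention in \<open>Xh_loc\<close> gives 0. Hence evaluation at the
  mesh vertices is injective on \<open>X i\<close>.\<close>

lemma Xh_loc_vanish:
  assumes v: "v \<in> X i" and 0: "\<And>p. p \<in> mesh_verts (Tr i) \<Longrightarrow> v p = 0"
  shows "v = (\<lambda>x. 0)"
proof
  fix x
  show "v x = 0"
  proof (cases "x \<in> closure (Om i)")
    case True
    then obtain T where T: "T \<in> Tr i" "x \<in> T" using mesh by auto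
    obtain c where c: "\<And>y. y \<in> T \<Longrightarrow> v y = c + tri_grad T v \<bullet> y"
      using Xh_loc_affine[OF v T(1)] by blast
    note tri = is_triD[OF mesh_triangle[OF T(1)]]
    have v0: "c + tri_grad T v \<bullet> p = 0" if "p \<in> verts T" for p
    proof -
      have "p \<in> T" using that tri(5) hull_inc[of p "verts T" convex] by simp
      then show ?thesis using 0[of p] c[of p] that T(1) by (auto simp: mesh_verts_def)
    qed
    have "x \<in> convex hull verts T" using T tri by simp
    then obtain w where w: "sum w (verts T) = 1" "(\<Sum>p\<in>verts T. w p *\<^sub>R p) = x"
      using tri(4) by (auto simp: convex_hull_finite)
    have "v x = c * sum w (verts T) + tri_grad T v \<bullet> (\<Sum>p\<in>verts T. w p *\<^sub>R p)"
      using c[OF T(2)] w by simp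
    also have "\<dots> = (\<Sum>p\<in>verts T. w p * (c + tri_grad T v \<bullet> p))"
      by (simp add: inner_sum_right sum_distrib_left distrib_left sum.distrib mult.commute[of c])
    also have "\<dots> = 0" using v0 by simp
    finally show ?thesis .
  qed (use v in \<open>auto simp: Xh_loc_def\<close>)
qed

section \<open>Integrals over a subdomain: the stiffness and mass forms\<close>

text \<open>On a triangle, \<open>f\<close> differs from a continuous function at most on the
  frontier, which is negligible by convexity. Absolute integrability then passes to the finite union
  and to its open subset \<open>Om i\<close>. The values of \<kappa> and \<open>grad\<close> on the
  mesh skeleton are thus immaterial.\<close>

lemma piecewise_continuous_integrable:
  fixes f :: "pt \<Rightarrow> real"
  assumes f: "\<And>T. T \<in> Tr i \<Longrightarrow> \<exists>\<phi>. continuous_on T \<phi> \<and> (\<forall>x\<in>interior T. f x = \<phi> x)"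
  shows "integrable (lebesgue_on (Om i)) f"
proof -
  have "f absolutely_integrable_on T" if T: "T \<in> Tr i" for T
  proof -
    note tri = is_triD[OF mesh_triangle[OF T]]
    obtain \<phi> where \<phi>: "continuous_on T \<phi>" "\<And>x. x \<in> interior T \<Longrightarrow> f x = \<phi> x"
      using f[OF T] by auto
    have "integrable lborel (\<lambda>x. indicator T x *\<^sub>R \<phi> x)"
      using borel_integrable_compact[OF tri(1) \<phi>(1)] by simp
    then have "\<phi> absolutely_integrable_on T"
      by (simp add: set_integrable_def integrable_completion)
    then show ?thesis
      by (rule absolutely_integrable_spike[OF _ negligible_convex_frontier[OF tri(2)]])
        (use tri(1) compact_imp_closed \<phi>(2) in \<open>auto simp: frontier_def\<close>)
  qed
  then have "f absolutely_integrable_on (\<Union>T\<in>Tr i. T)"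
    using mesh(1) is_triD(1)[OF mesh_triangle, THEN compact_imp_closed]
    by (intro set_integrable_UN) auto
  then have "f absolutely_integrable_on closure (Om i)"
    using mesh by simp
  then have "f absolutely_integrable_on Om i"
    by (rule set_integrable_subset) (use subdomain_open closure_subset[of "Om i"] in auto)
  then show ?thesis
    using subdomain_open by (simp add: set_integrable_def integrable_restrict_space)
qed

text \<open>\<open>grad\<close> is controlled only inside triangles; as the skeleton is null,
  identities of integrands may be checked there alone.\<close>

lemma AE_interior_triangle: "AE x in lebesgue_on (Om i). \<exists>T\<in>Tr i. x \<in> interior T"
proof (rule AE_I')
  have "negligible (\<Union>T\<in>Tr i. frontier T)"
    using mesh is_triD(2) mesh_triangle by (intro negligible_Union) (auto intro!: negligible_convex_frontier)
  then have "negligible (Om i \<inter> (\<Union>T\<in>Tr i. frontier T))"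
    by (rule negligible_subset) auto
  then show "Om i \<inter> (\<Union>T\<in>Tr i. frontier T) \<in> null_sets (lebesgue_on (Om i))"
    using subdomain_open by (simp add: null_sets_restrict_space negligible_iff_null_sets)
  show "{x \<in> space (lebesgue_on (Om i)). \<not> (\<exists>T\<in>Tr i. x \<in> interior T)}
      \<subseteq> Om i \<inter> (\<Union>T\<in>Tr i. frontier T)"
  proof clarsimp
    fix x assume x: "x \<in> Om i" and "\<forall>T\<in>Tr i. x \<notin> interior T"
    then obtain T where "T \<in> Tr i" "x \<in> T" "x \<notin> interior T"
      using mesh(3) closure_subset[of "Om i"] by blast
    then show "\<exists>T\<in>Tr i. x \<in> frontier T"
      using closure_subset[of T] by (auto simp: frontier_def)
  qed
qed

lemma a_loc_integrable:
  assumes u: "u \<in> X i" and v: "v \<in> X i"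
  shows "integrable (lebesgue_on (Om i)) (\<lambda>x. \<kappa> x * (grad u x \<bullet> grad v x))"
proof (rule piecewise_continuous_integrable)
  fix T assume T: "T \<in> Tr i"
  obtain k where "\<And>x. x \<in> interior T \<Longrightarrow> \<kappa> x = k" using coefficient_const[OF T] by blast
  then show "\<exists>\<phi>. continuous_on T \<phi> \<and> (\<forall>x\<in>interior T. \<kappa> x * (grad u x \<bullet> grad v x) = \<phi> x)"
    using grad_eq_tri_grad[OF u T] grad_eq_tri_grad[OF v T]
    by (intro exI[of _ "\<lambda>x. k * (tri_grad T u \<bullet> tri_grad T v)"]) auto
qed

lemma m_loc_integrable:
  assumes u: "u \<in> X i" and v: "v \<in> X i"
  shows "integrable (lebesgue_on (Om i)) (\<lambda>x. \<kappa> x * u x * v x)"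
proof (rule piecewise_continuous_integrable)
  fix T assume T: "T \<in> Tr i"
  obtain k where "\<And>x. x \<in> interior T \<Longrightarrow> \<kappa> x = k" using coefficient_const[OF T] by blast
  moreover have "continuous_on T u" "continuous_on T v"
    using u v triangle_subset[OF T] by (auto simp: Xh_loc_def intro: continuous_on_subset)
  ultimately show "\<exists>\<phi>. continuous_on T \<phi> \<and> (\<forall>x\<in>interior T. \<kappa> x * u x * v x = \<phi> x)"
    by (intro exI[of _ "\<lambda>x. k * u x * v x"]) (auto intro!: continuous_intros)
qed

lemma a_loc_comb:
  assumes u: "u \<in> X i" and v: "v \<in> X i" and z: "z \<in> X i"
  shows "a_loc Om \<kappa> i (\<lambda>x. u x + c * v x) z = a_loc Om \<kappa> i u z + c * a_loc Om \<kappa> i v z"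
proof -
  let ?w = "\<lambda>x. u x + c * v x"
  have "AE x in lebesgue_on (Om i). \<kappa> x * (grad ?w x \<bullet> grad z x) =
      \<kappa> x * (grad u x \<bullet> grad z x) + c * (\<kappa> x * (grad v x \<bullet> grad z x))"
    using AE_interior_triangle
  proof (rule AE_mp, intro AE_I2 impI)
    fix x assume "\<exists>T\<in>Tr i. x \<in> interior T"
    then obtain T where T: "T \<in> Tr i" "x \<in> interior T" by auto
    then have "grad ?w x = grad u x + c *\<^sub>R grad v x"
      using grad_eq_tri_grad[OF u T] grad_eq_tri_grad[OF v T] tri_grad_comb[OF u v T(1)]
        grad_eq_tri_grad[OF Xh_loc_comb[OF u v] T] by simp
    then show "\<kappa> x * (grad ?w x \<bullet> grad z x) =
      \<kappa> x * (grad u x \<bullet> grad z x) + c * (\<kappa> x * (grad v x \<bullet> grad z x))"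
      by (simp add: inner_add_left algebra_simps)
  qed
  then have "a_loc Om \<kappa> i ?w z = integral\<^sup>L (lebesgue_on (Om i))
      (\<lambda>x. \<kappa> x * (grad u x \<bullet> grad z x) + c * (\<kappa> x * (grad v x \<bullet> grad z x)))"
    unfolding a_loc_def
    by (intro integral_cong_AE borel_measurable_integrable Bochner_Integration.integrable_add
        integrable_mult_right a_loc_integrable Xh_loc_comb u v z)
  also have "\<dots> = a_loc Om \<kappa> i u z + c * a_loc Om \<kappa> i v z"
    unfolding a_loc_def using a_loc_integrable[OF u z] a_loc_integrable[OF v z] by simp
  finally show ?thesis .
qed

lemma m_loc_comb:
  assumes u: "u \<in> X i" and v: "v \<in> X i" and z: "z \<in> X i"
  shows "m_loc Om \<kappa> i (\<lambda>x. u x + c * v x) z = m_loc Om \<kappa> i u z + c * m_loc Om \<kappa> i v z"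
proof -
  have "m_loc Om \<kappa> i (\<lambda>x. u x + c * v x) z = integral\<^sup>L (lebesgue_on (Om i))
      (\<lambda>x. \<kappa> x * u x * z x + c * (\<kappa> x * v x * z x))"
    unfolding m_loc_def by (intro arg_cong[where f = "integral\<^sup>L _"] ext) (simp add: algebra_simps)
  also have "\<dots> = m_loc Om \<kappa> i u z + c * m_loc Om \<kappa> i v z"
    unfolding m_loc_def using m_loc_integrable[OF u z] m_loc_integrable[OF v z] by simp
  finally show ?thesis .
qed

text \<open>True for an arbitrary function: the integrand is pointwise nonnegative, and without
  integrability the integral is 0.\<close>

lemma a_loc_nonneg: "0 \<le> a_loc Om \<kappa> i u u"
  unfolding a_loc_def
  by (rule Bochner_Integration.integral_nonneg)
    (auto simp: space_restrict_space less_imp_le coefficient_pos)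

lemma m_loc_nonneg: "0 \<le> m_loc Om \<kappa> i u u"
  unfolding m_loc_def
  by (rule Bochner_Integration.integral_nonneg)
    (auto simp: space_restrict_space less_imp_le coefficient_pos mult.assoc)

section \<open>Traces and normal derivatives on edges\<close>

lemma finite_mesh_faces: "finite (mesh_faces (Tr i))"
  unfolding mesh_faces_def using mesh is_triD(4) mesh_triangle by auto

lemma closed_mesh_faces:
  assumes "S \<in> mesh_faces (Tr i)"
  shows "closed S"
proof -
  obtain T V where "T \<in> Tr i" "V \<subseteq> verts T" "S = convex hull V"
    using assms by (auto simp: mesh_faces_def)
  moreover from this have "finite V"
    using finite_subset is_triD(4)[OF mesh_triangle] by auto
  ultimately show ?thesis
    using finite_imp_compact_convex_hull compact_imp_closed by auto
qed

lemma triangle_in_mesh_faces: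
  assumes "T \<in> Tr i"
  shows "T \<in> mesh_faces (Tr i)"
  unfolding mesh_faces_def using assms is_triD(5)[OF mesh_triangle[OF assms]] by blast

lemma tri_at_mem:
  assumes "x \<in> closure (Om i)"
  shows "tri_at Tr i x \<in> Tr i" "x \<in> tri_at Tr i x"
proof -
  have "\<exists>T. T \<in> Tr i \<and> x \<in> T" using assms mesh by auto
  then have "tri_at Tr i x \<in> Tr i \<and> x \<in> tri_at Tr i x"
    unfolding tri_at_def by (rule someI_ex)
  then show "tri_at Tr i x \<in> Tr i" "x \<in> tri_at Tr i x" by auto
qed

text \<open>Triangles are themselves faces, so the two choice predicates are equal, and
  \<open>SOME\<close> makes the same choice for equal predicates.\<close>

lemma tri_at_signature:
  assumes "\<And>S. S \<in> mesh_faces (Tr i) \<Longrightarrow> x \<in> S \<longleftrightarrow> y \<in> S"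
  shows "tri_at Tr i x = tri_at Tr i y"
proof -
  have "(\<lambda>T. T \<in> Tr i \<and> x \<in> T) = (\<lambda>T. T \<in> Tr i \<and> y \<in> T)"
    using assms triangle_in_mesh_faces by auto
  then show ?thesis by (simp add: tri_at_def)
qed

lemma ktrace_signature:
  assumes "\<And>S. S \<in> mesh_faces (Tr i) \<Longrightarrow> x \<in> S \<longleftrightarrow> y \<in> S"
  shows "ktrace Tr \<kappa> i x = ktrace Tr \<kappa> i y"
  unfolding ktrace_def using tri_at_signature[OF assms] by simp

lemma ktrace_pos:
  assumes "x \<in> closure (Om i)"
  shows "0 < ktrace Tr \<kappa> i x"
proof -
  let ?T = "tri_at Tr i x"
  have T: "?T \<in> Tr i" using tri_at_mem assms by auto
  obtain k where k: "k > 0" "\<And>x. x \<in> interior ?T \<Longrightarrow> \<kappa> x = k"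
    using coefficient_const[OF T] by blast
  have "(SOME y. y \<in> interior ?T) \<in> interior ?T"
    using is_triD(3)[OF mesh_triangle[OF T]] by (simp add: some_in_eq)
  then show ?thesis using k by (simp add: ktrace_def tri_val_def)
qed

text \<open>Transferring support directions from \<open>x\<close> to \<open>y\<close> and back shows
  that both \<open>THE\<close> predicates have the same solutions. The normals therefore agree even
  at vertices or interior points, where no unique normal exists.\<close>

lemma tri_normal_signature:
  assumes T: "T \<in> Tr i" and x: "x \<in> T" and y: "y \<in> T"
    and sig: "\<And>S. S \<in> mesh_faces (Tr i) \<Longrightarrow> x \<in> S \<longleftrightarrow> y \<in> S"
  shows "tri_normal T x = tri_normal T y"
proof -
  note tri = is_triD[OF mesh_triangle[OF T]]
  have hull: "x \<in> convex hull V \<longleftrightarrow> y \<in> convex hull V" if "V \<subseteq> verts T" for V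
    using sig[of "convex hull V"] that T by (auto simp: mesh_faces_def)
  have "(\<forall>z\<in>T. n \<bullet> (z - x) \<le> 0) \<longleftrightarrow> (\<forall>z\<in>T. n \<bullet> (z - y) \<le> 0)" for n
    using support_direction_transfer[of "verts T" x y n] support_direction_transfer[of "verts T" y x n]
      tri(4) x y hull tri(5) by metis
  then show ?thesis by (simp add: tri_normal_def)
qed

lemma normal_deriv_comb:
  assumes "u \<in> X i" "v \<in> X i" "x \<in> closure (Om i)"
  shows "normal_deriv Tr i (\<lambda>x. u x + c * v x) x = normal_deriv Tr i u x + c * normal_deriv Tr i v x"
  using tri_grad_comb[OF assms(1,2) tri_at_mem(1)[OF assms(3)]]
  by (simp add: normal_deriv_def inner_add_left)

context
  fixes E assumes E: "closed E" "E \<subseteq> closure (Om i)"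
begin

lemma compact_part: "compact E"
  using E bounded_subset[OF bounded_closure[OF subdomain_bounded]] by (simp add: compact_eq_bounded_closed)

lemma bdd_borel_on_Xh_loc: "u \<in> X i \<Longrightarrow> bdd_borel_on E u"
  using compact_part E
  by (intro bdd_borel_on_continuous) (auto simp: Xh_loc_def intro: continuous_on_subset)

lemma bdd_borel_on_ktrace: "bdd_borel_on E (ktrace Tr \<kappa> i)"
  by (rule bdd_borel_on_signature[OF finite_mesh_faces closed_mesh_faces E(1)])
    (auto intro: ktrace_signature)

lemma bdd_borel_on_normal_deriv: "bdd_borel_on E (normal_deriv Tr i u)"
proof (rule bdd_borel_on_signature[OF finite_mesh_faces closed_mesh_faces E(1)])
  fix x y assume "x \<in> E" "y \<in> E"
    and sig: "\<And>S. S \<in> mesh_faces (Tr i) \<Longrightarrow> x \<in> S \<longleftrightarrow> y \<in> S"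
  then have "tri_at Tr i x = tri_at Tr i y"
    "tri_normal (tri_at Tr i x) x = tri_normal (tri_at Tr i x) y"
    using tri_at_signature[OF sig] tri_at_mem[of x] tri_at_mem[of y] E tri_normal_signature[OF _ _ _ sig]
    by auto
  then show "normal_deriv Tr i u x = normal_deriv Tr i u y"
    by (simp add: normal_deriv_def)
qed

end

end

lemma frontier_part: "closed (frontier (Om i))" "frontier (Om i) \<subseteq> closure (Om i)"
  by (auto simp: frontier_def)

lemma iface_part:
  "closed (iface Om i j)" "iface Om i j \<subseteq> closure (Om i)" "iface Om i j \<subseteq> closure (Om j)"
  by (auto simp: iface_def frontier_def)

lemma iface_commute: "iface Om i j = iface Om j i"
  by (auto simp: iface_def)

lemma kap_ij_commute: "kap_ij Tr \<kappa> i j x = kap_ij Tr \<kappa> j i x"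
  by (simp add: kap_ij_def mult_ac add.commute)

lemma h_ij_commute: "h_ij Tr i j = h_ij Tr j i"
  by (simp add: h_ij_def mult_ac add.commute)

lemma h_ij_nonneg: "i \<in> {1..N} \<Longrightarrow> j \<in> {1..N} \<Longrightarrow> 0 \<le> h_ij Tr i j"
  unfolding h_ij_def using mesh_size_nonneg by simp

lemma kap_ij_pos:
  assumes "i \<in> {1..N}" "j \<in> {1..N}" "x \<in> iface Om i j"
  shows "0 < kap_ij Tr \<kappa> i j x"
proof -
  have "0 < ktrace Tr \<kappa> i x" "0 < ktrace Tr \<kappa> j x"
    using ktrace_pos assms iface_part[of i j] by blast+
  then show ?thesis unfolding kap_ij_def by simp
qed

text \<open>The two meshes need not match across the interface, so the signature records the faces
  of both.\<close>

lemma bdd_borel_on_kap_ij: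
  assumes i: "i \<in> {1..N}" and j: "j \<in> {1..N}"
  shows "bdd_borel_on (iface Om i j) (kap_ij Tr \<kappa> i j)"
proof (rule bdd_borel_on_signature)
  show "finite (mesh_faces (Tr i) \<union> mesh_faces (Tr j))"
    using finite_mesh_faces i j by simp
  show "closed S" if "S \<in> mesh_faces (Tr i) \<union> mesh_faces (Tr j)" for S
    using that closed_mesh_faces i j by auto
  show "closed (iface Om i j)" by (rule iface_part)
  show "kap_ij Tr \<kappa> i j x = kap_ij Tr \<kappa> i j y"
    if "\<And>S. S \<in> mesh_faces (Tr i) \<union> mesh_faces (Tr j) \<Longrightarrow> x \<in> S \<longleftrightarrow> y \<in> S" for x y
    unfolding kap_ij_def using ktrace_signature[OF i, of x y] ktrace_signature[OF j, of x y] that by simp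
qed

lemmas bdd_borel_on_intros =
  bdd_borel_on_mult bdd_borel_on_add bdd_borel_on_diff bdd_borel_on_const bdd_borel_on_kap_ij
  bdd_borel_on_ktrace[OF _ frontier_part]
  bdd_borel_on_normal_deriv[OF _ frontier_part] bdd_borel_on_normal_deriv[OF _ iface_part(1,2)]
  bdd_borel_on_Xh_loc[OF _ frontier_part]
  bdd_borel_on_Xh_loc[OF _ iface_part(1,2)] bdd_borel_on_Xh_loc[OF _ iface_part(1,3)]

section \<open>Bilinearity and symmetry of the edge and DG forms\<close>

lemma mdelta_loc_comb:
  assumes i: "i \<in> {1..N}" and mem: "u \<in> X i" "v \<in> X i" "z \<in> X i"
  shows "mdelta_loc Omega N Om Tr \<kappa> \<delta> i (\<lambda>x. u x + c * v x) z =
    mdelta_loc Omega N Om Tr \<kappa> \<delta> i u z + c * mdelta_loc Omega N Om Tr \<kappa> \<delta> i v z"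
proof -
  have E: "seg_integral (iface Om i j) (\<lambda>x. kap_ij Tr \<kappa> i j x * (u x + c * v x) * z x) =
      seg_integral (iface Om i j) (\<lambda>x. kap_ij Tr \<kappa> i j x * u x * z x) +
      c * seg_integral (iface Om i j) (\<lambda>x. kap_ij Tr \<kappa> i j x * v x * z x)"
    if "j \<in> {1..N}" for j
    by (rule seg_integral_linear)
      ((intro bdd_borel_on_intros that i mem)+, simp add: algebra_simps)
  have B: "bnd_integral Omega Om Tr i (\<lambda>x. ktrace Tr \<kappa> i x * (u x + c * v x) * z x) =
      bnd_integral Omega Om Tr i (\<lambda>x. ktrace Tr \<kappa> i x * u x * z x) +
      c * bnd_integral Omega Om Tr i (\<lambda>x. ktrace Tr \<kappa> i x * v x * z x)"
    by (rule bnd_integral_linear)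
      ((intro bdd_borel_on_intros i mem)+, simp add: algebra_simps)
  show ?thesis
    unfolding mdelta_loc_def B using E
    by (simp add: algebra_simps sum.distrib sum_distrib_left)
qed

lemma p_loc_comb:
  assumes i: "i \<in> {1..N}" and mem: "u \<in> Xh N Om Tr" "v \<in> Xh N Om Tr" "z \<in> Xh N Om Tr"
  shows "p_loc Omega N Om Tr \<kappa> \<delta> i (\<lambda>i x. u i x + c * v i x) z =
    p_loc Omega N Om Tr \<kappa> \<delta> i u z + c * p_loc Omega N Om Tr \<kappa> \<delta> i v z"
proof -
  have mem: "u j \<in> X j" "v j \<in> X j" "z j \<in> X j" if "j \<in> {1..N}" for j
    using that mem by (auto simp: Xh_def)
  have E: "seg_integral (iface Om i j)
        (\<lambda>x. kap_ij Tr \<kappa> i j x * (u j x + c * v j x - (u i x + c * v i x)) * (z j x - z i x)) =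
      seg_integral (iface Om i j) (\<lambda>x. kap_ij Tr \<kappa> i j x * (u j x - u i x) * (z j x - z i x)) +
      c * seg_integral (iface Om i j) (\<lambda>x. kap_ij Tr \<kappa> i j x * (v j x - v i x) * (z j x - z i x))"
    if j: "j \<in> {1..N}" for j
    by (rule seg_integral_linear)
      ((intro bdd_borel_on_intros i j mem)+, simp add: algebra_simps)
  have B: "bnd_integral Omega Om Tr i (\<lambda>x. ktrace Tr \<kappa> i x * (0 - (u i x + c * v i x)) * (0 - z i x)) =
      bnd_integral Omega Om Tr i (\<lambda>x. ktrace Tr \<kappa> i x * (0 - u i x) * (0 - z i x)) +
      c * bnd_integral Omega Om Tr i (\<lambda>x. ktrace Tr \<kappa> i x * (0 - v i x) * (0 - z i x))"
    by (rule bnd_integral_linear)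
      ((intro bdd_borel_on_intros i mem)+, simp add: algebra_simps)
  show ?thesis
    unfolding p_loc_def B using E
    by (simp add: distrib_left sum.distrib sum_distrib_left mult_ac)
qed

lemma s_loc_comb:
  assumes i: "i \<in> {1..N}" and mem: "u \<in> Xh N Om Tr" "v \<in> Xh N Om Tr" "z \<in> Xh N Om Tr"
  shows "s_loc Omega N Om Tr \<kappa> i (\<lambda>i x. u i x + c * v i x) z =
    s_loc Omega N Om Tr \<kappa> i u z + c * s_loc Omega N Om Tr \<kappa> i v z"
proof -
  have mem: "u j \<in> X j" "v j \<in> X j" "z j \<in> X j" if "j \<in> {1..N}" for j
    using that mem by (auto simp: Xh_def)
  let ?w = "\<lambda>i x. u i x + c * v i x"
  \<comment> \<open>Only on the closure of the subdomain does \<open>tri_at\<close> return a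
    triangle of the mesh, so linearity is claimed there.\<close>
  have nd: "normal_deriv Tr i (?w i) x = normal_deriv Tr i (u i) x + c * normal_deriv Tr i (v i) x"
    if "x \<in> closure (Om i)" for x
    using normal_deriv_comb[OF i] mem[OF i] that by simp
  let ?I = "\<lambda>u j x. kap_ij Tr \<kappa> i j x *
      (normal_deriv Tr i (u i) x * (z j x - z i x) + normal_deriv Tr i (z i) x * (u j x - u i x))"
  let ?J = "\<lambda>u x. ktrace Tr \<kappa> i x *
      (normal_deriv Tr i (u i) x * (0 - z i x) + normal_deriv Tr i (z i) x * (0 - u i x))"
  have E: "seg_integral (iface Om i j) (?I ?w j) =
      seg_integral (iface Om i j) (?I u j) + c * seg_integral (iface Om i j) (?I v j)"
    if j: "j \<in> {1..N}" for j
  proof (rule seg_integral_linear)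
    show "?I ?w j x = ?I u j x + c * ?I v j x" if "x \<in> iface Om i j" for x
      using nd[of x] iface_part(2)[of i j] that by (auto simp: algebra_simps)
  qed (intro bdd_borel_on_intros i j mem)+
  have B: "bnd_integral Omega Om Tr i (?J ?w) =
      bnd_integral Omega Om Tr i (?J u) + c * bnd_integral Omega Om Tr i (?J v)"
  proof (rule bnd_integral_linear)
    show "?J ?w x = ?J u x + c * ?J v x" if "x \<in> frontier (Om i)" for x
      using nd[of x] frontier_part(2)[of i] that by (auto simp: algebra_simps)
  qed (intro bdd_borel_on_intros i mem)+
  show ?thesis
    unfolding s_loc_def B using E
    by (simp add: distrib_left sum.distrib sum_distrib_left mult_ac)
qed

lemma aDG_comb:
  assumes "u \<in> Xh N Om Tr" "v \<in> Xh N Om Tr" "z \<in> Xh N Om Tr"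
  shows "aDG Omega N Om Tr \<kappa> \<delta> (\<lambda>i x. u i x + c * v i x) z =
    aDG Omega N Om Tr \<kappa> \<delta> u z + c * aDG Omega N Om Tr \<kappa> \<delta> v z"
  unfolding aDG_def sum_distrib_left sum.distrib[symmetric]
proof (rule sum.cong[OF refl])
  fix i assume i: "i \<in> {1..N}"
  then have "u i \<in> X i" "v i \<in> X i" "z i \<in> X i"
    using assms by (auto simp: Xh_def)
  then show "a_loc Om \<kappa> i (\<lambda>x. u i x + c * v i x) (z i) + s_loc Omega N Om Tr \<kappa> i (\<lambda>i x. u i x + c * v i x) z
        + p_loc Omega N Om Tr \<kappa> \<delta> i (\<lambda>i x. u i x + c * v i x) z =
      a_loc Om \<kappa> i (u i) (z i) + s_loc Omega N Om Tr \<kappa> i u z + p_loc Omega N Om Tr \<kappa> \<delta> i u z +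
      c * (a_loc Om \<kappa> i (v i) (z i) + s_loc Omega N Om Tr \<kappa> i v z + p_loc Omega N Om Tr \<kappa> \<delta> i v z)"
    using a_loc_comb[OF i] s_loc_comb[OF i assms] p_loc_comb[OF i assms] by (simp add: algebra_simps)
qed

lemma a_loc_commute: "a_loc Om \<kappa> i u v = a_loc Om \<kappa> i v u"
  by (simp add: a_loc_def inner_commute)

lemma m_loc_commute: "m_loc Om \<kappa> i u v = m_loc Om \<kappa> i v u"
  by (simp add: m_loc_def mult_ac)

lemma mdelta_loc_commute:
  "mdelta_loc Omega N Om Tr \<kappa> \<delta> i u v = mdelta_loc Omega N Om Tr \<kappa> \<delta> i v u"
  by (simp add: mdelta_loc_def mult_ac)

text \<open>Exchanging the arguments swaps the consistency term and the symmetrising term of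
  \<open>s_loc\<close>.\<close>

lemma aDG_commute: "aDG Omega N Om Tr \<kappa> \<delta> u v = aDG Omega N Om Tr \<kappa> \<delta> v u"
proof -
  have "s_loc Omega N Om Tr \<kappa> i u v = s_loc Omega N Om Tr \<kappa> i v u" for i
    unfolding s_loc_def by (simp only: add.commute)
  moreover have "p_loc Omega N Om Tr \<kappa> \<delta> i u v = p_loc Omega N Om Tr \<kappa> \<delta> i v u" for i
    unfolding p_loc_def by (simp only: mult_ac)
  ultimately show ?thesis
    unfolding aDG_def by (simp add: a_loc_commute)
qed

lemma Xh_comb:
  assumes "u \<in> Xh N Om Tr" "v \<in> Xh N Om Tr"
  shows "(\<lambda>i x. u i x + c * v i x) \<in> Xh N Om Tr"
  using assms Xh_loc_comb by (auto simp: Xh_def)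

lemma aDG_expand:
  assumes u: "u \<in> Xh N Om Tr" and v: "v \<in> Xh N Om Tr"
  shows "aDG Omega N Om Tr \<kappa> \<delta> (\<lambda>i x. u i x + c * v i x) (\<lambda>i x. u i x + c * v i x) =
    aDG Omega N Om Tr \<kappa> \<delta> u u + 2 * c * aDG Omega N Om Tr \<kappa> \<delta> u v + c\<^sup>2 * aDG Omega N Om Tr \<kappa> \<delta> v v"
proof -
  let ?w = "\<lambda>i x. u i x + c * v i x" and ?A = "aDG Omega N Om Tr \<kappa> \<delta>"
  have w: "?w \<in> Xh N Om Tr" using Xh_comb[OF u v] .
  have "?A ?w ?w = ?A u ?w + c * ?A v ?w" by (rule aDG_comb[OF u v w])
  also have "\<dots> = ?A ?w u + c * ?A ?w v"
    using aDG_commute[of \<delta> u ?w] aDG_commute[of \<delta> v ?w] by simp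
  also have "\<dots> = ?A u u + c * ?A v u + c * (?A u v + c * ?A v v)"
    using aDG_comb[OF u v u] aDG_comb[OF u v v] by simp
  finally show ?thesis
    using aDG_commute[of \<delta> v u] by (simp add: algebra_simps power2_eq_square)
qed

lemma a_loc_bilinear:
  assumes "i \<in> {1..N}"
  shows "sym_bilinear_on (X i) (a_loc Om \<kappa> i)"
  by unfold_locales (use assms Xh_loc_zero Xh_loc_comb a_loc_comb a_loc_commute in auto)

lemma mass_bilinear:
  assumes "i \<in> {1..N}"
  shows "sym_bilinear_on (X i) (\<lambda>u v. m_loc Om \<kappa> i u v + mdelta_loc Omega N Om Tr \<kappa> \<delta> i u v)"
  by unfold_locales
    (use assms Xh_loc_zero Xh_loc_comb m_loc_comb mdelta_loc_comb m_loc_commute mdelta_loc_commute in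
      \<open>auto simp: distrib_left\<close>)

section \<open>Positivity, and the penalty bounded by the boundary mass\<close>

lemma p_loc_nonneg:
  assumes i: "i \<in> {1..N}" and "0 \<le> \<delta>"
  shows "0 \<le> p_loc Omega N Om Tr \<kappa> \<delta> i u u"
proof -
  have "0 \<le> seg_integral (iface Om i j) (\<lambda>x. kap_ij Tr \<kappa> i j x * (u j x - u i x) * (u j x - u i x))"
    if "j \<in> {1..N}" for j
    using kap_ij_pos[OF i that] by (intro seg_integral_nonneg) (simp add: less_imp_le mult.assoc)
  moreover have "0 \<le> bnd_integral Omega Om Tr i (\<lambda>x. ktrace Tr \<kappa> i x * (0 - u i x) * (0 - u i x))"
    using ktrace_pos[OF i] frontier_part[of i]
    by (intro bnd_integral_nonneg) (auto simp: less_imp_le mult.assoc)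
  ultimately show ?thesis
    unfolding p_loc_def using assms mesh_size_nonneg[OF i] h_ij_nonneg[OF i]
    by (intro add_nonneg_nonneg sum_nonneg mult_nonneg_nonneg) auto
qed

lemma dh_nonneg:
  assumes "0 \<le> \<delta>"
  shows "0 \<le> dh Omega N Om Tr \<kappa> \<delta> u u"
  unfolding dh_def using assms by (intro sum_nonneg add_nonneg_nonneg a_loc_nonneg p_loc_nonneg) auto

text \<open>Each interface integral of \<open>(r\<^sub>j - r\<^sub>i)\<^sup>2 \<le> 2 r\<^sub>i\<^sup>2 + 2 r\<^sub>j\<^sup>2\<close> is seen from both sides, which gives
  the factor 4.\<close>

lemma sum_p_loc_le:
  assumes r: "r \<in> Xh N Om Tr" and \<delta>: "0 \<le> \<delta>"
  shows "(\<Sum>i\<in>{1..N}. p_loc Omega N Om Tr \<kappa> \<delta> i r r)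
    \<le> 4 * (\<Sum>i\<in>{1..N}. mdelta_loc Omega N Om Tr \<kappa> \<delta> i (r i) (r i))"
proof -
  \<comment> \<open>Weighted mass of \<open>r i\<close> on the interface. The weights are symmetric
    in \<open>i\<close> and \<open>j\<close>, so \<open>q j i\<close> is the mass of
    \<open>r j\<close> on the same edge.\<close>
  define q where "q i j = 1/2 * (\<delta> / h_ij Tr i j) *
      seg_integral (iface Om i j) (\<lambda>x. kap_ij Tr \<kappa> i j x * r i x * r i x)" for i j
  define b where "b i = \<delta> / mesh_size (Tr i) *
      bnd_integral Omega Om Tr i (\<lambda>x. ktrace Tr \<kappa> i x * r i x * r i x)" for i
  have mem: "r i \<in> X i" if "i \<in> {1..N}" for i
    using r that by (auto simp: Xh_def)
  have b: "0 \<le> b i" if i: "i \<in> {1..N}" for i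
  proof -
    have "0 \<le> ktrace Tr \<kappa> i x * r i x * r i x" if "x \<in> frontier (Om i)" for x
    proof -
      have "0 < ktrace Tr \<kappa> i x" using ktrace_pos[OF i] frontier_part(2)[of i] that by blast
      then show ?thesis by (simp add: mult.assoc)
    qed
    then show ?thesis
      unfolding b_def using \<delta> mesh_size_nonneg[OF i]
      by (intro mult_nonneg_nonneg[OF _ bnd_integral_nonneg]) auto
  qed
  have jump: "1/2 * (\<delta> / h_ij Tr i j) *
        seg_integral (iface Om i j) (\<lambda>x. kap_ij Tr \<kappa> i j x * (r j x - r i x) * (r j x - r i x))
      \<le> 2 * q i j + 2 * q j i" if i: "i \<in> {1..N}" and j: "j \<in> {1..N}" for i j
  proof -
    let ?k = "kap_ij Tr \<kappa> i j" and ?E = "iface Om i j"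
    have "seg_integral ?E (\<lambda>x. ?k x * (r j x - r i x) * (r j x - r i x))
        \<le> seg_integral ?E (\<lambda>x. 2 * (?k x * r i x * r i x) + 2 * (?k x * r j x * r j x))"
    proof (rule seg_integral_mono)
      fix x assume "x \<in> ?E"
      \<comment> \<open>This is exactly the right-hand side minus the left-hand side of the claimed
        inequality.\<close>
      then have "0 \<le> ?k x * (r j x + r i x)\<^sup>2"
        using kap_ij_pos[OF i j] by (intro mult_nonneg_nonneg) (auto simp: less_imp_le)
      then show "?k x * (r j x - r i x) * (r j x - r i x)
          \<le> 2 * (?k x * r i x * r i x) + 2 * (?k x * r j x * r j x)"
        by (simp add: power2_eq_square algebra_simps)
    qed (intro bdd_borel_on_intros i j mem)+
    also have "\<dots> = seg_integral ?E (\<lambda>x. 2 * (?k x * r i x * r i x)) +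
        2 * seg_integral ?E (\<lambda>x. ?k x * r j x * r j x)"
      by (rule seg_integral_linear) (intro bdd_borel_on_intros i j mem refl)+
    \<comment> \<open>The factor 2 is split off by writing the integrand as g + 1 g.\<close>
    also have "seg_integral ?E (\<lambda>x. 2 * (?k x * r i x * r i x)) =
        seg_integral ?E (\<lambda>x. ?k x * r i x * r i x) + 1 * seg_integral ?E (\<lambda>x. ?k x * r i x * r i x)"
      by (rule seg_integral_linear) (intro bdd_borel_on_intros i j mem | simp)+
    finally have "1/2 * (\<delta> / h_ij Tr i j) *
        seg_integral ?E (\<lambda>x. ?k x * (r j x - r i x) * (r j x - r i x))
      \<le> 1/2 * (\<delta> / h_ij Tr i j) * (2 * seg_integral ?E (\<lambda>x. ?k x * r i x * r i x) +
          2 * seg_integral ?E (\<lambda>x. ?k x * r j x * r j x))"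
      using \<delta> h_ij_nonneg[OF i j] by (intro mult_left_mono) auto
    also have "\<dots> = 2 * q i j + 2 * q j i"
      unfolding q_def iface_commute[of j i] h_ij_commute[of j i] kap_ij_commute[of j i]
      by (simp only: distrib_left mult_ac)
    finally show ?thesis .
  qed
  \<comment> \<open>The inner index set depends on \<open>i\<close>; adding and subtracting the
    diagonal turns it into a full square, where the order of summation can be exchanged.\<close>
  have swap: "(\<Sum>i\<in>{1..N}. \<Sum>j\<in>{1..N} - {i}. q j i) = (\<Sum>i\<in>{1..N}. \<Sum>j\<in>{1..N} - {i}. q i j)"
  proof -
    have "(\<Sum>i\<in>{1..N}. \<Sum>j\<in>{1..N} - {i}. q j i) = (\<Sum>i\<in>{1..N}. (\<Sum>j\<in>{1..N}. q j i) - q i i)"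
      by (intro sum.cong refl) (simp add: sum_diff1)
    also have "\<dots> = (\<Sum>i\<in>{1..N}. (\<Sum>j\<in>{1..N}. q i j) - q i i)"
      by (simp add: sum_subtractf sum.swap[of q])
    also have "\<dots> = (\<Sum>i\<in>{1..N}. \<Sum>j\<in>{1..N} - {i}. q i j)"
      by (intro sum.cong refl) (simp add: sum_diff1)
    finally show ?thesis .
  qed
  have "(\<Sum>i\<in>{1..N}. p_loc Omega N Om Tr \<kappa> \<delta> i r r)
      \<le> (\<Sum>i\<in>{1..N}. (\<Sum>j\<in>{1..N} - {i}. 2 * q i j + 2 * q j i) + b i)"
  proof (rule sum_mono)
    fix i assume i: "i \<in> {1..N}"
    have "\<delta> / mesh_size (Tr i) * bnd_integral Omega Om Tr i
        (\<lambda>x. ktrace Tr \<kappa> i x * (0 - r i x) * (0 - r i x)) = b i"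
      by (simp add: b_def)
    then show "p_loc Omega N Om Tr \<kappa> \<delta> i r r
        \<le> (\<Sum>j\<in>{1..N} - {i}. 2 * q i j + 2 * q j i) + b i"
      unfolding p_loc_def using jump[OF i] by (intro add_mono sum_mono) auto
  qed
  also have "\<dots> = (\<Sum>i\<in>{1..N}. 4 * (\<Sum>j\<in>{1..N} - {i}. q i j) + b i)"
    using swap by (simp add: sum.distrib flip: sum_distrib_left)
  \<comment> \<open>The outer boundary term occurs only once, as there is no neighbour; being
    nonnegative, it may be enlarged to the common factor 4.\<close>
  also have "\<dots> \<le> (\<Sum>i\<in>{1..N}. 4 * ((\<Sum>j\<in>{1..N} - {i}. q i j) + b i))"
    using b by (intro sum_mono) simp
  finally show ?thesis
    by (simp add: mdelta_loc_def q_def b_def sum_distrib_left)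
qed

section \<open>Eigenfunction expansion and its tail\<close>

text \<open>Together with \<open>u\<close> there is one function more than there are mesh vertices.
  Some nontrivial combination vanishes at all vertices, hence everywhere, and orthonormality forces
  \<open>u\<close> to occur in it. This replaces a dimension count.\<close>

lemma eigen_expansion:
  assumes i: "i \<in> {1..N}" and eig: "eigenpairs Omega N Om Tr \<kappa> \<delta> i lam psi" and u: "u \<in> X i"
  shows "u = (\<lambda>x. \<Sum>l\<in>{1..card (mesh_verts (Tr i))}.
    (m_loc Om \<kappa> i u (psi l) + mdelta_loc Omega N Om Tr \<kappa> \<delta> i u (psi l)) * psi l x)"
proof -
  let ?n = "card (mesh_verts (Tr i))"
  define M where "M u v = m_loc Om \<kappa> i u v + mdelta_loc Omega N Om Tr \<kappa> \<delta> i u v" for u v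
  interpret sym_bilinear_on "X i" M
    unfolding M_def by (rule mass_bilinear[OF i])
  have psi: "psi l \<in> X i" if "l \<in> {1..?n}" for l
    using eig that by (auto simp: eigenpairs_def Let_def)
  have orth: "M (psi l) (psi k) = (if l = k then 1 else 0)" if "l \<in> {1..?n}" "k \<in> {1..?n}" for l k
    using eig that by (auto simp: eigenpairs_def Let_def M_def)
  have coeff: "M (\<lambda>x. \<Sum>l\<in>{1..?n}. c l * psi l x) (psi k) = c k" if k: "k \<in> {1..?n}" for c k
  proof -
    have "M (\<lambda>x. \<Sum>l\<in>{1..?n}. c l * psi l x) (psi k) = (\<Sum>l\<in>{1..?n}. c l * M (psi l) (psi k))"
      by (rule sum_left[OF psi psi[OF k]])
    also have "\<dots> = (\<Sum>l\<in>{1..?n}. if l = k then c l else 0)"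
      using orth[OF _ k] by (intro sum.cong) auto
    finally show ?thesis using k by simp
  qed
  \<comment> \<open>Index 0 is free for \<open>u\<close>. The dependence lemma works with indexed
    families, so \<open>u\<close> may coincide with an eigenfunction.\<close>
  define F where "F l = (if l = 0 then u else psi l)" for l
  obtain c where c: "\<exists>l\<in>{0..?n}. c l \<noteq> 0"
    and c0: "\<And>p. p \<in> mesh_verts (Tr i) \<Longrightarrow> (\<Sum>l\<in>{0..?n}. c l * F l p) = 0"
    using nontrivial_dependence[OF finite_mesh_verts[OF i], of "{0..?n}" F] by auto
  have split: "(\<Sum>l\<in>{0..?n}. c l * F l x) = (\<Sum>l\<in>{1..?n}. c l * psi l x) + c 0 * u x" for x
    by (simp add: sum.atLeast_Suc_atMost F_def)
  have S: "(\<lambda>x. \<Sum>l\<in>{1..?n}. c l * psi l x) \<in> X i"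
    by (rule sum_mem[OF psi])
  have "(\<lambda>x. (\<Sum>l\<in>{1..?n}. c l * psi l x) + c 0 * u x) = (\<lambda>x. 0)"
    using c0 split by (intro Xh_loc_vanish[OF i comb_mem[OF S u]]) auto
  then have rel: "(\<Sum>l\<in>{1..?n}. c l * psi l x) + c 0 * u x = 0" for x
    by metis
  have "c 0 \<noteq> 0"
  proof
    assume "c 0 = 0"
    \<comment> \<open>Without \<open>u\<close>, testing the relation against \<open>psi k\<close> in
      the mass form isolates \<open>c k\<close>.\<close>
    then have "c k = 0" if "k \<in> {1..?n}" for k
      using rel coeff[OF that, of c] zero_left[OF psi[OF that]] by simp
    then show False using c \<open>c 0 = 0\<close> by (metis One_nat_def Suc_leI atLeastAtMost_iff neq0_conv)
  qed
  define d where "d l = - c l / c 0" for l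
  have ud: "u = (\<lambda>x. \<Sum>l\<in>{1..?n}. d l * psi l x)"
  proof
    fix x
    have "u x = - (\<Sum>l\<in>{1..?n}. c l * psi l x) / c 0"
      using rel[of x] \<open>c 0 \<noteq> 0\<close> by (simp add: field_simps)
    then show "u x = (\<Sum>l\<in>{1..?n}. d l * psi l x)"
      by (simp add: d_def sum_divide_distrib sum_negf)
  qed
  then have "M u (psi k) = d k" if "k \<in> {1..?n}" for k
    using coeff[OF that, of d] by simp
  then have "u = (\<lambda>x. \<Sum>l\<in>{1..?n}. M u (psi l) * psi l x)"
    by (subst ud) auto
  then show ?thesis by (simp add: M_def)
qed

text \<open>\<open>\<mu>\<close> is any positive lower bound for the first discarded eigenvalue, so
  one minimum over all subdomains can serve every \<open>i\<close>. For the last bound, the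
  nonnegative \<open>m_loc\<close> part is added and Parseval applied; each coefficient then costs a
  factor lam l / \<mu>, which is at least 1.\<close>

lemma eigen_tail:
  fixes c :: "nat \<Rightarrow> real"
  assumes i: "i \<in> {1..N}" and eig: "eigenpairs Omega N Om Tr \<kappa> \<delta> i lam psi"
    and L: "L < card (mesh_verts (Tr i))" and pos: "0 < \<mu>" "\<mu> \<le> lam (L + 1)"
  defines "tail \<equiv> \<lambda>x. \<Sum>l\<in>{L + 1..card (mesh_verts (Tr i))}. c l * psi l x"
  shows "tail \<in> X i"
    and "a_loc Om \<kappa> i tail tail = (\<Sum>l\<in>{L + 1..card (mesh_verts (Tr i))}. lam l * (c l)\<^sup>2)"
    and "mdelta_loc Omega N Om Tr \<kappa> \<delta> i tail tail
      \<le> (\<Sum>l\<in>{L + 1..card (mesh_verts (Tr i))}. lam l * (c l)\<^sup>2) / \<mu>"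
proof -
  let ?n = "card (mesh_verts (Tr i))"
  interpret A: sym_bilinear_on "X i" "a_loc Om \<kappa> i" by (rule a_loc_bilinear[OF i])
  interpret M: sym_bilinear_on "X i" "\<lambda>u v. m_loc Om \<kappa> i u v + mdelta_loc Omega N Om Tr \<kappa> \<delta> i u v"
    by (rule mass_bilinear[OF i])
  have psi: "psi l \<in> X i" if "l \<in> {1..?n}" for l
    using eig that by (auto simp: eigenpairs_def Let_def)
  have orth: "m_loc Om \<kappa> i (psi l) (psi k) + mdelta_loc Omega N Om Tr \<kappa> \<delta> i (psi l) (psi k)
      = (if l = k then 1 else 0)" if "l \<in> {1..?n}" "k \<in> {1..?n}" for l k
    using eig that by (auto simp: eigenpairs_def Let_def)
  \<comment> \<open>The eigenvalue equation tested with \<open>psi k\<close> turns mass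
    orthonormality into orthogonality for \<open>a_loc\<close>.\<close>
  have a_orth: "a_loc Om \<kappa> i (psi l) (psi k) = (if l = k then lam l else 0)"
    if "l \<in> {1..?n}" "k \<in> {1..?n}" for l k
    using eig that psi orth[OF that] by (auto simp: eigenpairs_def Let_def)
  show "tail \<in> X i"
    unfolding tail_def by (rule A.sum_mem) (auto intro: psi)
  show "a_loc Om \<kappa> i tail tail = (\<Sum>l\<in>{L + 1..?n}. lam l * (c l)\<^sup>2)"
    unfolding tail_def by (rule A.sum_diagonal) (auto intro: psi simp: a_orth)
  have "mdelta_loc Omega N Om Tr \<kappa> \<delta> i tail tail
      \<le> m_loc Om \<kappa> i tail tail + mdelta_loc Omega N Om Tr \<kappa> \<delta> i tail tail"
    using m_loc_nonneg[OF i] by simp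
  also have "\<dots> = (\<Sum>l\<in>{L + 1..?n}. 1 * (c l)\<^sup>2)"
    unfolding tail_def by (rule M.sum_diagonal) (auto intro: psi simp: orth)
  also have "\<dots> \<le> (\<Sum>l\<in>{L + 1..?n}. lam l * (c l)\<^sup>2 / \<mu>)"
  proof (rule sum_mono)
    fix l assume l: "l \<in> {L + 1..?n}"
    have "\<forall>l\<in>{1..?n}. \<forall>k\<in>{1..?n}. l \<le> k \<longrightarrow> lam l \<le> lam k"
      using eig by (simp add: eigenpairs_def Let_def)
    then have "lam (L + 1) \<le> lam l" using l L by auto
    then have "\<mu> * (c l)\<^sup>2 \<le> lam l * (c l)\<^sup>2"
      using pos by (intro mult_right_mono) auto
    then show "1 * (c l)\<^sup>2 \<le> lam l * (c l)\<^sup>2 / \<mu>"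
      using pos by (simp add: field_simps)
  qed
  finally show "mdelta_loc Omega N Om Tr \<kappa> \<delta> i tail tail
      \<le> (\<Sum>l\<in>{L + 1..?n}. lam l * (c l)\<^sup>2) / \<mu>"
    by (simp add: sum_divide_distrib)
qed

text \<open>In the expansion of A(e + w, e + w) the mixed term is zero and A(w,w) is nonnegative by
  coercivity. The lower equivalence is then used for \<open>e\<close> and the upper one for the
  sum.\<close>

lemma galerkin_error_le:
  assumes \<delta>: "0 < \<delta>" and \<gamma>: "0 < \<gamma>0" "0 < \<gamma>1"
    and equiv: "\<And>u. u \<in> Xh N Om Tr \<Longrightarrow>
        \<gamma>0 * dh Omega N Om Tr \<kappa> \<delta> u u \<le> aDG Omega N Om Tr \<kappa> \<delta> u u \<and>
        aDG Omega N Om Tr \<kappa> \<delta> u u \<le> \<gamma>1 * dh Omega N Om Tr \<kappa> \<delta> u u"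
    and e: "e \<in> Xh N Om Tr" and w: "w \<in> Xh N Om Tr"
    and orth: "aDG Omega N Om Tr \<kappa> \<delta> e w = 0"
  shows "dh Omega N Om Tr \<kappa> \<delta> e e
    \<le> \<gamma>1 / \<gamma>0 * dh Omega N Om Tr \<kappa> \<delta> (\<lambda>i x. e i x + w i x) (\<lambda>i x. e i x + w i x)"
proof -
  let ?A = "aDG Omega N Om Tr \<kappa> \<delta>" and ?r = "\<lambda>i x. e i x + w i x"
  have r: "?r \<in> Xh N Om Tr" using Xh_comb[OF e w, of 1] by simp
  have "0 \<le> \<gamma>0 * dh Omega N Om Tr \<kappa> \<delta> w w" using dh_nonneg[of \<delta> w] \<delta> \<gamma> by simp
  also have "\<dots> \<le> ?A w w" using equiv[OF w] by simp
  finally have "?A e e \<le> ?A ?r ?r" using aDG_expand[OF e w, of \<delta> 1] orth by simp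
  then have "\<gamma>0 * dh Omega N Om Tr \<kappa> \<delta> e e \<le> \<gamma>1 * dh Omega N Om Tr \<kappa> \<delta> ?r ?r"
    using equiv[OF e] equiv[OF r] by linarith
  then show ?thesis using \<gamma> by (simp add: field_simps)
qed

end

section \<open>The error estimate\<close>

theorem theorem3p5:
  fixes \<gamma>0 \<gamma>1 \<delta> :: real
  assumes "0 < \<gamma>0" and "0 < \<gamma>1" and "0 < \<delta>"
  shows "\<exists>C1::real. \<forall>(Omega::pt set) (N::nat) (Om::nat \<Rightarrow> pt set) (Tr::nat \<Rightarrow> pt set set)
      (\<kappa>::pt \<Rightarrow> real) (f::pt \<Rightarrow> real) (lam::nat \<Rightarrow> nat \<Rightarrow> real)
      (psi::nat \<Rightarrow> nat \<Rightarrow> pt \<Rightarrow> real) (L::nat \<Rightarrow> nat) (uh::nat \<Rightarrow> pt \<Rightarrow> real)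
      (ums::nat \<Rightarrow> pt \<Rightarrow> real).
    dg_setting Omega N Om Tr \<kappa> \<and>
    f \<in> borel_measurable (lebesgue_on Omega) \<and> integrable (lebesgue_on Omega) (\<lambda>x. (f x)\<^sup>2) \<and>
    (\<forall>u\<in>Xh N Om Tr.
        \<gamma>0 * dh Omega N Om Tr \<kappa> \<delta> u u \<le> aDG Omega N Om Tr \<kappa> \<delta> u u \<and>
        aDG Omega N Om Tr \<kappa> \<delta> u u \<le> \<gamma>1 * dh Omega N Om Tr \<kappa> \<delta> u u) \<and>
    (\<forall>i\<in>{1..N}. eigenpairs Omega N Om Tr \<kappa> \<delta> i (lam i) (psi i) \<and>
        L i < card (mesh_verts (Tr i)) \<and> 0 < lam i (L i + 1)) \<and>
    uh \<in> Xh N Om Tr \<and>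
    (\<forall>v\<in>Xh N Om Tr. aDG Omega N Om Tr \<kappa> \<delta> uh v = f_form N Om f v) \<and>
    ums \<in> XH2 N psi L \<and>
    (\<forall>v\<in>XH2 N psi L. aDG Omega N Om Tr \<kappa> \<delta> ums v = f_form N Om f v)
    \<longrightarrow>
    dh Omega N Om Tr \<kappa> \<delta> (\<lambda>i x. uh i x - ums i x) (\<lambda>i x. uh i x - ums i x)
      \<le> C1 * (1 + 4 / Min ((\<lambda>i. lam i (L i + 1)) ` {1..N})) *
         (\<Sum>i\<in>{1..N}. \<Sum>l\<in>{L i + 1..card (mesh_verts (Tr i))}.
            lam i l * (m_loc Om \<kappa> i (uh i) (psi i l)
                       + mdelta_loc Omega N Om Tr \<kappa> \<delta> i (uh i) (psi i l))\<^sup>2)"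
\<comment> \<open>The witness is fixed before the domain, the mesh, \<kappa> and the solutions are
  introduced, which is the claimed independence.\<close>
proof (intro exI[of _ "\<gamma>1 / \<gamma>0"] allI impI, elim conjE)
  fix Omega N Om Tr \<kappa> f lam psi L uh ums
  assume setting: "dg_setting Omega N Om Tr \<kappa>"
    and equiv: "\<forall>u\<in>Xh N Om Tr.
        \<gamma>0 * dh Omega N Om Tr \<kappa> \<delta> u u \<le> aDG Omega N Om Tr \<kappa> \<delta> u u \<and>
        aDG Omega N Om Tr \<kappa> \<delta> u u \<le> \<gamma>1 * dh Omega N Om Tr \<kappa> \<delta> u u"
    and eig_all: "\<forall>i\<in>{1..N}. eigenpairs Omega N Om Tr \<kappa> \<delta> i (lam i) (psi i) \<and>
        L i < card (mesh_verts (Tr i)) \<and> 0 < lam i (L i + 1)"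
    and uh: "uh \<in> Xh N Om Tr"
    and uh_eq: "\<forall>v\<in>Xh N Om Tr. aDG Omega N Om Tr \<kappa> \<delta> uh v = f_form N Om f v"
    and ums: "ums \<in> XH2 N psi L"
    and ums_eq: "\<forall>v\<in>XH2 N psi L. aDG Omega N Om Tr \<kappa> \<delta> ums v = f_form N Om f v"
  interpret dg_decomposition Omega N Om Tr \<kappa> by unfold_locales (rule setting)
  let ?A = "aDG Omega N Om Tr \<kappa> \<delta>" and ?D = "dh Omega N Om Tr \<kappa> \<delta>"
  let ?n = "\<lambda>i. card (mesh_verts (Tr i))"
  define \<mu> where "\<mu> = Min ((\<lambda>i. lam i (L i + 1)) ` {1..N})"
  define c where "c i l = m_loc Om \<kappa> i (uh i) (psi i l) + mdelta_loc Omega N Om Tr \<kappa> \<delta> i (uh i) (psi i l)"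
    for i l
  define S where "S i = (\<Sum>l\<in>{L i + 1..?n i}. lam i l * (c i l)\<^sup>2)" for i
  define w where "w i x = (\<Sum>l\<in>{1..L i}. c i l * psi i l x)" for i x
  have eig: "eigenpairs Omega N Om Tr \<kappa> \<delta> i (lam i) (psi i)" and L: "L i < ?n i"
    if "i \<in> {1..N}" for i
    using eig_all that by auto
  have \<mu>_pos: "0 < \<mu>"
    unfolding \<mu>_def using eig_all N_pos by (subst Min_gr_iff) auto
  have \<mu>_le: "\<mu> \<le> lam i (L i + 1)" if "i \<in> {1..N}" for i
    unfolding \<mu>_def using that by (intro Min_le) auto
  have coarse: "v \<in> Xh N Om Tr" if v: "v \<in> XH2 N psi L" for v
    unfolding Xh_def
  proof (intro CollectI ballI)
    fix i assume i: "i \<in> {1..N}"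
    \<comment> \<open>Supplies \<open>sum_mem\<close>; the bound on \<open>L i\<close> keeps the
      coarse indices within the range of the eigenpairs.\<close>
    interpret sym_bilinear_on "X i" "a_loc Om \<kappa> i" by (rule a_loc_bilinear[OF i])
    obtain d where "v i = (\<lambda>x. \<Sum>l\<in>{1..L i}. d l * psi i l x)"
      using v i unfolding XH2_def by blast
    moreover have "psi i l \<in> X i" if "l \<in> {1..L i}" for l
      using eig[OF i] L[OF i] that by (auto simp: eigenpairs_def Let_def)
    ultimately show "v i \<in> X i" using sum_mem[of "{1..L i}" "psi i" d] by simp
  qed
  \<comment> \<open>Chosen so that \<open>e + z\<close> equals \<open>uh\<close> minus its
    truncation \<open>w\<close>; lying in the coarse space, \<open>z\<close> is an admissible test
    function in both equations.\<close>
  define z where "z i x = ums i x - w i x" for i x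
  have z: "z \<in> XH2 N psi L"
    unfolding XH2_def
  proof (intro CollectI ballI)
    fix i assume "i \<in> {1..N}"
    then obtain d where "ums i = (\<lambda>x. \<Sum>l\<in>{1..L i}. d l * psi i l x)"
      using ums unfolding XH2_def by blast
    then have "z i = (\<lambda>x. \<Sum>l\<in>{1..L i}. (d l - c i l) * psi i l x)"
      by (auto simp: z_def[abs_def] w_def left_diff_distrib sum_subtractf)
    then show "\<exists>c. z i = (\<lambda>x. \<Sum>l\<in>{1..L i}. c l * psi i l x)"
      by (rule exI[of _ "\<lambda>l. d l - c i l"])
  qed
  define e where "e = (\<lambda>i x. uh i x - ums i x)"
  have e: "e \<in> Xh N Om Tr"
    using Xh_comb[OF uh coarse[OF ums], of "-1"] by (simp add: e_def)
  have "?A e z = ?A uh z - ?A ums z"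
    using aDG_comb[OF uh coarse[OF ums] coarse[OF z], of \<delta> "-1"] by (simp add: e_def)
  then have orth: "?A e z = 0"
    using uh_eq ums_eq z coarse[OF z] by simp
  define r where "r = (\<lambda>i x. e i x + z i x)"
  have r: "r \<in> Xh N Om Tr"
    using Xh_comb[OF e coarse[OF z], of 1] by (simp add: r_def)
  have r_tail: "r i = (\<lambda>x. \<Sum>l\<in>{L i + 1..?n i}. c i l * psi i l x)" if i: "i \<in> {1..N}" for i
  proof
    fix x
    have "uh i \<in> X i" using uh i by (auto simp: Xh_def)
    then have "uh i x = (\<Sum>l\<in>{1..?n i}. c i l * psi i l x)"
      using eigen_expansion[OF i eig[OF i], of "uh i"] unfolding c_def by metis
    also have "{1..?n i} = {1..L i} \<union> {L i + 1..?n i}"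
      using L[OF i] by auto
    also have "(\<Sum>l\<in>\<dots>. c i l * psi i l x) = w i x + (\<Sum>l\<in>{L i + 1..?n i}. c i l * psi i l x)"
      by (subst sum.union_disjoint) (auto simp: w_def)
    finally show "r i x = (\<Sum>l\<in>{L i + 1..?n i}. c i l * psi i l x)"
      by (simp add: r_def e_def z_def)
  qed
  have a_r: "a_loc Om \<kappa> i (r i) (r i) = S i"
    and m_r: "mdelta_loc Omega N Om Tr \<kappa> \<delta> i (r i) (r i) \<le> S i / \<mu>" if i: "i \<in> {1..N}" for i
    using eigen_tail(2,3)[OF i eig[OF i] L[OF i] \<mu>_pos \<mu>_le[OF i], of "c i"]
    by (simp_all add: r_tail[OF i] S_def)
  have "?D r r = (\<Sum>i\<in>{1..N}. S i) + (\<Sum>i\<in>{1..N}. p_loc Omega N Om Tr \<kappa> \<delta> i r r)"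
    unfolding dh_def by (simp add: sum.distrib a_r)
  \<comment> \<open>The summand 1 in the final factor is the stiffness energy of the tail; 4 / \<mu>
    is its penalty, with 4 from the two-sided jumps and 1 / \<mu> from the spectral gap.\<close>
  also have "\<dots> \<le> (\<Sum>i\<in>{1..N}. S i) + 4 * (\<Sum>i\<in>{1..N}. S i / \<mu>)"
    using sum_p_loc_le[OF r, of \<delta>] assms
      sum_mono[of "{1..N}" "\<lambda>i. mdelta_loc Omega N Om Tr \<kappa> \<delta> i (r i) (r i)", OF m_r] by simp
  also have "\<dots> = (1 + 4 / \<mu>) * (\<Sum>i\<in>{1..N}. S i)"
    by (simp add: distrib_right flip: sum_divide_distrib)
  finally have D_r: "?D r r \<le> (1 + 4 / \<mu>) * (\<Sum>i\<in>{1..N}. S i)" .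
  have "?D e e \<le> \<gamma>1 / \<gamma>0 * ?D r r"
    unfolding r_def using equiv by (intro galerkin_error_le assms e coarse z orth) auto
  also have "\<dots> \<le> \<gamma>1 / \<gamma>0 * ((1 + 4 / \<mu>) * (\<Sum>i\<in>{1..N}. S i))"
    using D_r assms by (intro mult_left_mono) auto
  finally show "?D (\<lambda>i x. uh i x - ums i x) (\<lambda>i x. uh i x - ums i x)
      \<le> \<gamma>1 / \<gamma>0 * (1 + 4 / Min ((\<lambda>i. lam i (L i + 1)) ` {1..N})) *
         (\<Sum>i\<in>{1..N}. \<Sum>l\<in>{L i + 1..card (mesh_verts (Tr i))}.
            lam i l * (m_loc Om \<kappa> i (uh i) (psi i l)
                       + mdelta_loc Omega N Om Tr \<kappa> \<delta> i (uh i) (psi i l))\<^sup>2)"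
    unfolding e_def S_def c_def \<mu>_def by (simp add: mult.assoc)
qed

end
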